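(* Let $n\ge 1$ be an integer, let $I\subset\mathbb{R}$ be a nonempty open interval, let $M\subset\mathbb{R}^n$ be an open set, and let $v\colon I\times M\to\mathbb{R}^n$ be an $r$ times continuously differentiable function for some integer $r\ge 1$. Assume that there is a continuous function $L\colon I\to[0,+\infty[$ such that $$\|v(t,x_1)-v(t,x_2)\|\le L(t)\,\|x_1-x_2\|\qquad (t\in I,\ x_1,x_2\in M).$$ Assume further that for every $t_0\in I$ and $x_0\in M$ the unique maximal solution of the Cauchy problem $\dot{x}(t)=v(t,x(t))$, $x(t_0)=x_0$, cannot leave the domain $I\times M$, i.e. it is defined on the whole of $I$ with values in $M$. Then the direction field of the equation $\dot{x}=v(t,x)$ is globally rectifiable by a time-preserving diffeomorphism of class $\mathscr{C}^r$. In particular, there exists a time-preserving $\mathscr{C}^r$-diffeomorphism $\Phi\colon I\times M\to I\times M$ such that $\Phi^{-1}$ maps the field $1\frac{\partial}{\partial t}+v\frac{\partial}{\partial x}$ to the constant field $1\frac{\partial}{\partial t}+0\frac{\partial}{\partial x}$, i.e. $$\left(\Phi^{-1}\right)_{\ast(t,x)}\bigl(1,\,v(t,x)\bigr)=(1,0)\in\mathbb{R}\times\mathbb{R}^n\qquad\text{for all }(t,x)\in I\times M.$$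
   Context: For a differentiable map $f$, $f_{\ast p}$ denotes its derivative (the linear tangent map) at the point $p$. The direction field of the equation $\dot{x}=v(t,x)$ on $I\times M$ is the field of directions spanned at each point $(t,x)$ by the vector $1\frac{\partial}{\partial t}+v(t,x)\frac{\partial}{\partial x}$, i.e. by $(1,v(t,x))\in\mathbb{R}\times\mathbb{R}^n$. A rectification of a direction field is a diffeomorphism mapping the direction field into a field of parallel directions; the field is globally rectifiable if there is a rectification defined on all of $I\times M$. A diffeomorphism $\Phi\colon I\times M\to I\times N$ is time-preserving if $\Phi(t,x)=(t,\varphi(t,x))$ for some continuously differentiable map $\varphi\colon I\times M\to N$. A $\mathscr{C}^r$-diffeomorphism is a bijection such that both it and its inverse are $r$ times continuously differentiable. *)

theory Defs
  imports "HOL-Analysis.Analysis"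
begin

text \<open>
  Maps of class $C^k$ on an open set. The derivative is tested against each fixed direction
  \<open>h\<close>, so that the recursion stays within one function type. As the domain type has finite
  dimension, this says that all partial derivatives up to order \<open>k\<close> exist and are continuous.
  Derivatives are taken \<open>at x\<close>, not \<open>at x within S\<close>, so the notion is only meant for open \<open>S\<close>.
\<close>

primrec Ck_on :: "nat \<Rightarrow> ('a::euclidean_space \<Rightarrow> 'b::euclidean_space) \<Rightarrow> 'a set \<Rightarrow> bool" where
  "Ck_on 0 f S \<longleftrightarrow> continuous_on S f"
| "Ck_on (Suc k) f S \<longleftrightarrow> (\<forall>x\<in>S. f differentiable (at x)) \<and>
     (\<forall>h. Ck_on k (\<lambda>x. frechet_derivative f (at x) h) S)"

definition Ck_diffeo ::
    "nat \<Rightarrow> 'a::euclidean_space set \<Rightarrow> 'b::euclidean_space set \<Rightarrow> ('a \<Rightarrow> 'b) \<Rightarrow> bool" where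
  "Ck_diffeo k D E F \<longleftrightarrow> open D \<and> open E \<and> bij_betw F D E \<and>
     Ck_on k F D \<and> Ck_on k (inv_into D F) E"

definition cauchy_solution ::
    "real set \<Rightarrow> 'a::euclidean_space set \<Rightarrow> (real \<times> 'a \<Rightarrow> 'a) \<Rightarrow> real \<Rightarrow> 'a
      \<Rightarrow> real set \<Rightarrow> (real \<Rightarrow> 'a) \<Rightarrow> bool" where
  "cauchy_solution I M v t0 x0 J x \<longleftrightarrow>
     open J \<and> is_interval J \<and> t0 \<in> J \<and> J \<subseteq> I \<and> x t0 = x0 \<and>
     (\<forall>t\<in>J. x t \<in> M \<and> (x has_vector_derivative v (t, x t)) (at t))"

definition maximal_cauchy_solution ::
    "real set \<Rightarrow> 'a::euclidean_space set \<Rightarrow> (real \<times> 'a \<Rightarrow> 'a) \<Rightarrow> real \<Rightarrow> 'a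
      \<Rightarrow> real set \<Rightarrow> (real \<Rightarrow> 'a) \<Rightarrow> bool" where
  "maximal_cauchy_solution I M v t0 x0 J x \<longleftrightarrow>
     cauchy_solution I M v t0 x0 J x \<and>
     (\<forall>J' y. cauchy_solution I M v t0 x0 J' y \<and> J \<subseteq> J' \<and> (\<forall>t\<in>J. y t = x t) \<longrightarrow> J' = J)"

text \<open>A field of directions assigns to each point a line through the origin.\<close>

definition direction_field ::
    "(real \<times> 'a::euclidean_space \<Rightarrow> 'a) \<Rightarrow> real \<times> 'a \<Rightarrow> (real \<times> 'a) set" where
  "direction_field v p = span {(1, v p)}"

definition parallel_directions ::
    "'b::euclidean_space set \<Rightarrow> ('b \<Rightarrow> 'b set) \<Rightarrow> bool" where
  "parallel_directions E \<eta> \<longleftrightarrow> (\<exists>l. subspace l \<and> dim l = 1 \<and> (\<forall>q\<in>E. \<eta> q = l))"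

definition rectification ::
    "nat \<Rightarrow> 'a::euclidean_space set \<Rightarrow> 'b::euclidean_space set \<Rightarrow> ('a \<Rightarrow> 'a set)
      \<Rightarrow> ('a \<Rightarrow> 'b) \<Rightarrow> bool" where
  "rectification k D E \<xi> F \<longleftrightarrow> Ck_diffeo k D E F \<and>
     (\<exists>\<eta>. parallel_directions E \<eta> \<and>
       (\<forall>p\<in>D. frechet_derivative F (at p) ` \<xi> p = \<eta> (F p)))"

definition time_preserving ::
    "real set \<Rightarrow> 'a::euclidean_space set \<Rightarrow> 'a set \<Rightarrow> (real \<times> 'a \<Rightarrow> real \<times> 'a) \<Rightarrow> bool" where
  "time_preserving I M N F \<longleftrightarrow>
     (\<exists>\<phi>. Ck_on 1 \<phi> (I \<times> M) \<and> \<phi> ` (I \<times> M) \<subseteq> N \<and>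
       (\<forall>t\<in>I. \<forall>x\<in>M. F (t, x) = (t, \<phi> (t, x))))"

end

theory Submission
  imports Defs
begin

text \<open>
  The rectifying map keeps the time of a point and slides the point along its trajectory to a fixed
  instant \<open>t0\<close>: it sends \<open>(t, x)\<close> to \<open>(t, flow t0 t x)\<close>, where \<open>flow \<sigma> \<tau> \<xi>\<close> denotes the value at time \<open>\<sigma>\<close> of the
  solution through \<open>(\<tau>, \<xi>)\<close>. By uniqueness of solutions its inverse sends \<open>(t, x)\<close> to
  \<open>(t, flow t t0 x)\<close>. Along the graph of a solution the sliding map has constant second component, so
  its derivative takes \<open>(1, v (t, x))\<close> to \<open>(1, 0)\<close>. Since every maximal solution is defined on all of
  \<open>I\<close>, both maps are defined on \<open>I \<times> M\<close>. What remains is that the flow exists and is of class \<open>C\<^sup>r\<close>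
  jointly in \<open>(\<sigma>, \<tau>, \<xi>)\<close>.

  For existence, the equation is made globally Lipschitz near a given point by a projection onto a ball, and
  solved by Picard iteration (\<open>picard_lindelof_global\<close>). Gronwall's inequality (\<open>gronwall_zero\<close>)
  gives uniqueness, and the union of all solutions through a point is the maximal one.

  For smoothness, time is rescaled to \<open>s \<in> [0,1]\<close> by \<open>\<tau> + s (\<sigma> - \<tau>)\<close>, which turns the flow into the solution
  at \<open>s = 1\<close> of an initial value problem with parameter \<open>p = (\<sigma>, \<tau>, \<xi>)\<close>. Thus only smooth dependence on
  parameters is needed (\<open>Ck_fam_solution\<close>), and differentiation in time never occurs. The
  derivative of a solution in a parameter direction solves the linear variational equation
  (\<open>has_derivative_solution\<close>), which is a problem of the same kind with the same parameters and
  state space, and with one order of smoothness less. This gives all orders by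
  induction. The Lipschitz hypothesis, uniform in the space variable, enters in the continuity of
  the solution in the parameter: it bounds the distance of two solutions by the defect of one of
  them in the equation of the other (\<open>uniformly_close\<close>).
\<close>

section \<open>Smooth maps depending continuously on time\<close>

text \<open>
  Families of \<open>C\<^sup>k\<close> maps depending continuously on a time \<open>s \<in> [0,1]\<close>: derivatives are taken
  in the space variable only, but all of them are jointly continuous in time and space. Nothing
  needs to be differentiated in \<open>s\<close>, so the time interval can be compact. Joint continuity
  has to be demanded at every order, since differentiability in \<open>x\<close> gives no control of the
  dependence on \<open>s\<close>.
\<close>

primrec Ck_fam ::
    "nat \<Rightarrow> (real \<Rightarrow> 'a::euclidean_space \<Rightarrow> 'b::euclidean_space) \<Rightarrow> 'a set \<Rightarrow> bool" where
  "Ck_fam 0 f S \<longleftrightarrow> continuous_on ({0..1} \<times> S) (\<lambda>q. f (fst q) (snd q))"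
| "Ck_fam (Suc k) f S \<longleftrightarrow> continuous_on ({0..1} \<times> S) (\<lambda>q. f (fst q) (snd q)) \<and>
     (\<forall>s\<in>{0..1}. \<forall>x\<in>S. f s differentiable (at x)) \<and>
     (\<forall>h. Ck_fam k (\<lambda>s x. frechet_derivative (f s) (at x) h) S)"

lemma Ck_fam_continuous:
  "Ck_fam k f S \<Longrightarrow> continuous_on ({0..1} \<times> S) (\<lambda>q. f (fst q) (snd q))"
  by (cases k) auto

lemma Ck_fam_has_derivative:
  assumes "Ck_fam (Suc k) f S" "s \<in> {0..1}" "x \<in> S"
  shows "(f s has_derivative frechet_derivative (f s) (at x)) (at x)"
  using assms by (simp add: frechet_derivative_works)

lemma Ck_fam_frechet:
  "Ck_fam (Suc k) f S \<Longrightarrow> Ck_fam k (\<lambda>s x. frechet_derivative (f s) (at x) h) S"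
  by simp

lemma Ck_fam_cong:
  assumes "Ck_fam k f S" "open S"
    and "\<And>s x. s \<in> {0..1} \<Longrightarrow> x \<in> S \<Longrightarrow> f s x = g s x"
  shows "Ck_fam k g S"
  using assms
proof (induction k arbitrary: f g)
  case 0
  have "continuous_on ({0..1} \<times> S) (\<lambda>q. g (fst q) (snd q))"
    using Ck_fam_continuous[OF 0(1)] by (rule continuous_on_eq) (use 0(3) in auto)
  then show ?case by simp
next
  case (Suc k)
  have cont: "continuous_on ({0..1} \<times> S) (\<lambda>q. g (fst q) (snd q))"
    using Ck_fam_continuous[OF Suc.prems(1)]
    by (rule continuous_on_eq) (use Suc.prems(3) in auto)
  have der: "(g s has_derivative frechet_derivative (f s) (at x)) (at x)"
    if "s \<in> {0..1}" "x \<in> S" for s x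
    using Ck_fam_has_derivative[OF Suc.prems(1) that] \<open>open S\<close> that(2)
    by (rule has_derivative_transform_within_open) (use Suc.prems(3) that in auto)
  have "Ck_fam k (\<lambda>s x. frechet_derivative (g s) (at x) h) S" for h
  proof (rule Suc.IH[OF Ck_fam_frechet[OF Suc.prems(1)] \<open>open S\<close>])
    fix s x assume "s \<in> {0..1::real}" "x \<in> S"
    then show "frechet_derivative (f s) (at x) h = frechet_derivative (g s) (at x) h"
      using frechet_derivative_at[OF der] by metis
  qed
  with cont der show ?case
    by (simp, blast intro: differentiableI)
qed

text \<open>
  The form in which smoothness is proved: any explicit derivative will do in place of the one
  selected by \<open>frechet_derivative\<close>.
\<close>

lemma Ck_fam_SucI:
  assumes "open S" "continuous_on ({0..1} \<times> S) (\<lambda>q. f (fst q) (snd q))"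
    and der: "\<And>s x. s \<in> {0..1} \<Longrightarrow> x \<in> S \<Longrightarrow> (f s has_derivative f' s x) (at x)"
    and "\<And>h. Ck_fam k (\<lambda>s x. f' s x h) S"
  shows "Ck_fam (Suc k) f S"
proof -
  have "Ck_fam k (\<lambda>s x. frechet_derivative (f s) (at x) h) S" for h
    using frechet_derivative_at[OF der]
    by (intro Ck_fam_cong[OF assms(4)[of h] \<open>open S\<close>]) simp
  with assms show ?thesis by (simp, blast intro: differentiableI)
qed

lemma Ck_fam_SucD: "Ck_fam (Suc k) f S \<Longrightarrow> Ck_fam k f S"
proof (induction k arbitrary: f)
  case (Suc k)
  show ?case
    unfolding Ck_fam.simps(2)[of k]
    using Suc.prems Suc.IH[OF Ck_fam_frechet[OF Suc.prems]] by simp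
qed auto

lemma Ck_fam_mono: "Ck_fam k f S \<Longrightarrow> j \<le> k \<Longrightarrow> Ck_fam j f S"
  by (induction k) (auto simp: le_Suc_eq simp del: Ck_fam.simps(2) dest: Ck_fam_SucD)

lemma Ck_fam_of_Ck_on:
  assumes "Ck_on k f S" "open S"
  shows "Ck_fam k (\<lambda>s. f) S"
  using assms
proof (induction k arbitrary: f)
  case 0
  then show ?case by (auto intro!: continuous_on_compose2[of S f] continuous_intros)
next
  case (Suc k)
  have "continuous_on S f"
    using Suc.prems by (auto intro!: continuous_at_imp_continuous_on differentiable_imp_continuous_within)
  then have "continuous_on ({0..1::real} \<times> S) (\<lambda>q. f (snd q))"
    by (auto intro!: continuous_on_compose2[of S f] continuous_intros)
  then show ?case using Suc by auto
qed

lemma Ck_on_of_Ck_fam: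
  assumes "Ck_fam k f S" "s \<in> {0..1}"
  shows "Ck_on k (f s) S"
  using assms
proof (induction k arbitrary: f)
  case 0
  have "continuous_on S (\<lambda>x. (s, x))"
    by (intro continuous_intros)
  from continuous_on_compose2[OF Ck_fam_continuous[OF 0(1)] this] 0(2) show ?case
    by force
qed auto

lemma Ck_on_cong:
  assumes "Ck_on k f S" "open S" "\<And>x. x \<in> S \<Longrightarrow> f x = g x"
  shows "Ck_on k g S"
  using Ck_on_of_Ck_fam[OF Ck_fam_cong[OF Ck_fam_of_Ck_on[OF assms(1,2)] assms(2)], of "\<lambda>s. g" 0] assms(3)
  by simp

lemma Ck_fam_const:
  fixes c :: "real \<Rightarrow> 'b::euclidean_space" and S :: "'a::euclidean_space set"
  assumes "continuous_on {0..1} c"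
  shows "Ck_fam k (\<lambda>s x. c s) S"
  using assms
proof (induction k arbitrary: c)
  case 0
  then show ?case by (auto intro!: continuous_on_compose2[of "{0..1}" c] continuous_intros)
next
  case (Suc k)
  then have "continuous_on ({0..1} \<times> S) (\<lambda>q. c (fst q))"
    by (auto intro!: continuous_on_compose2[of "{0..1}" c] continuous_intros)
  moreover have "Ck_fam k (\<lambda>s x. 0 :: 'b) S"
    by (rule Suc.IH) (rule continuous_on_const)
  ultimately show ?case by simp
qed

lemma Ck_fam_linear:
  assumes "bounded_linear l" "open S"
  shows "Ck_fam k (\<lambda>s x. l x) S"
proof (cases k)
  case 0
  then show ?thesis
    by (simp add: bounded_linear.continuous_on[OF assms(1)] continuous_on_snd)
next
  case (Suc j)
  have "Ck_fam (Suc j) (\<lambda>s x. l x) S"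
    by (rule Ck_fam_SucI[where f' = "\<lambda>s x. l"])
      (simp_all add: assms bounded_linear.continuous_on[OF assms(1)] continuous_on_snd
        bounded_linear_imp_has_derivative Ck_fam_const)
  with Suc show ?thesis by simp
qed

lemma Ck_fam_add:
  assumes "Ck_fam k f S" "Ck_fam k g S" "open S"
  shows "Ck_fam k (\<lambda>s x. f s x + g s x) S"
  using assms
proof (induction k arbitrary: f g)
  case 0
  then show ?case by (auto intro!: continuous_intros)
next
  case (Suc k)
  show ?case
    by (rule Ck_fam_SucI[where f' = "\<lambda>s x h. frechet_derivative (f s) (at x) h
          + frechet_derivative (g s) (at x) h"])
      (use Suc in \<open>simp_all add: continuous_on_add has_derivative_add frechet_derivative_works\<close>)
qed

lemma Ck_fam_sum:
  assumes "finite B" "\<And>i. i \<in> B \<Longrightarrow> Ck_fam k (f i) S" "open S"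
  shows "Ck_fam k (\<lambda>s x. \<Sum>i\<in>B. f i s x) S"
  using assms
  by (induction B rule: finite_induct) (auto intro!: Ck_fam_add Ck_fam_const)

lemma Ck_fam_scaleR:
  assumes "Ck_fam k a S" "Ck_fam k f S" "open S"
  shows "Ck_fam k (\<lambda>s x. a s x *\<^sub>R f s x) S"
  using assms
proof (induction k arbitrary: a f)
  case 0
  then show ?case by (auto intro!: continuous_intros)
next
  case (Suc k)
  have "Ck_fam k (\<lambda>s x. a s x *\<^sub>R frechet_derivative (f s) (at x) h
          + frechet_derivative (a s) (at x) h *\<^sub>R f s x) S" for h
    using Suc.prems by (intro Ck_fam_add Suc.IH Ck_fam_frechet Ck_fam_SucD[of k])
  then show ?case
    by (intro Ck_fam_SucI[where f' = "\<lambda>s x h. a s x *\<^sub>R frechet_derivative (f s) (at x) h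
          + frechet_derivative (a s) (at x) h *\<^sub>R f s x"])
      (use Suc.prems in \<open>simp_all add: continuous_on_scaleR has_derivative_scaleR
        frechet_derivative_works\<close>)
qed

lemma Ck_fam_linear_compose:
  assumes "bounded_linear l" "Ck_fam k f S" "open S"
  shows "Ck_fam k (\<lambda>s x. l (f s x)) S"
  using assms(2)
proof (induction k arbitrary: f)
  case 0
  then show ?case
    by (simp add: bounded_linear.continuous_on[OF assms(1)])
next
  case (Suc k)
  show ?case
    by (rule Ck_fam_SucI[where f' = "\<lambda>s x h. l (frechet_derivative (f s) (at x) h)"])
      (use Suc assms in \<open>simp_all add: bounded_linear.continuous_on[OF assms(1)]
        bounded_linear.has_derivative[OF assms(1)] frechet_derivative_works\<close>)
qed

lemma Ck_fam_Pair:
  fixes f :: "real \<Rightarrow> 'a::euclidean_space \<Rightarrow> 'b::euclidean_space"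
    and g :: "real \<Rightarrow> 'a \<Rightarrow> 'c::euclidean_space"
  assumes "Ck_fam k f S" "Ck_fam k g S" "open S"
  shows "Ck_fam k (\<lambda>s x. (f s x, g s x)) S"
proof -
  have "bounded_linear (\<lambda>x. (x::'b, 0::'c))" "bounded_linear (\<lambda>x. (0::'b, x::'c))"
    by (simp_all add: bounded_linear_Pair bounded_linear_ident bounded_linear_zero)
  then have "Ck_fam k (\<lambda>s x. (f s x, 0::'c)) S" "Ck_fam k (\<lambda>s x. (0::'b, g s x)) S"
    using Ck_fam_linear_compose assms by blast+
  then have "Ck_fam k (\<lambda>s x. (f s x, 0) + (0, g s x)) S"
    using \<open>open S\<close> by (rule Ck_fam_add)
  then show ?thesis by simp
qed

lemma linear_basis_sum:
  fixes l :: "'a::euclidean_space \<Rightarrow> 'b::real_vector"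
  assumes "linear l"
  shows "l y = (\<Sum>i\<in>Basis. (y \<bullet> i) *\<^sub>R l i)"
  using arg_cong[OF euclidean_representation[of y], of l, symmetric] assms
  by (simp add: linear_sum linear_scale)

text \<open>
  Smoothness of an operator-valued family is expressed through its values on fixed vectors, as the
  operators do not form a Euclidean space of their own. Expanding in a basis shows that this is
  enough to apply the operators to a smoothly varying vector.
\<close>

lemma Ck_fam_linear_apply:
  fixes A :: "real \<Rightarrow> 'a::euclidean_space \<Rightarrow> 'b::euclidean_space \<Rightarrow> 'c::euclidean_space"
  assumes "\<And>y. Ck_fam k (\<lambda>s x. A s x y) S" "Ck_fam k g S" "open S"
    and "\<And>s x. s \<in> {0..1} \<Longrightarrow> x \<in> S \<Longrightarrow> linear (A s x)"
  shows "Ck_fam k (\<lambda>s x. A s x (g s x)) S"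
proof (rule Ck_fam_cong)
  have "Ck_fam k (\<lambda>s x. g s x \<bullet> i) S" for i
    using bounded_linear_inner_left assms(2,3) by (rule Ck_fam_linear_compose)
  then show "Ck_fam k (\<lambda>s x. \<Sum>i\<in>Basis. (g s x \<bullet> i) *\<^sub>R A s x i) S"
    by (simp add: Ck_fam_sum Ck_fam_scaleR assms)
  show "(\<Sum>i\<in>Basis. (g s x \<bullet> i) *\<^sub>R A s x i) = A s x (g s x)" if "s \<in> {0..1}" "x \<in> S" for s x
    using linear_basis_sum[OF assms(4)[OF that], of "g s x"] by simp
qed fact

lemma continuous_on_fam_compose:
  assumes "continuous_on (T \<times> E) (\<lambda>q. g (fst q) (snd q))"
    and "continuous_on (T \<times> S) (\<lambda>q. f (fst q) (snd q))"
    and "\<And>s x. s \<in> T \<Longrightarrow> x \<in> S \<Longrightarrow> f s x \<in> E"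
  shows "continuous_on (T \<times> S) (\<lambda>q. g (fst q) (f (fst q) (snd q)))"
proof -
  have "continuous_on (T \<times> S) (\<lambda>q. (fst q, f (fst q) (snd q)))"
    by (intro continuous_intros assms(2))
  then show ?thesis
    using continuous_on_compose2[OF assms(1), of "T \<times> S" "\<lambda>q. (fst q, f (fst q) (snd q))"] assms(3)
    by (auto simp: image_subset_iff)
qed

text \<open>
  The induction runs over the order for all outer maps at once: the chain rule expresses the
  derivative of a composition through compositions with the derivative of the outer map.
\<close>

lemma Ck_fam_compose:
  assumes "Ck_fam k g E" "Ck_fam k f S" "open S"
    and "\<And>s x. s \<in> {0..1} \<Longrightarrow> x \<in> S \<Longrightarrow> f s x \<in> E"
  shows "Ck_fam k (\<lambda>s x. g s (f s x)) S"
  using assms(1,2)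
proof (induction k arbitrary: g)
  case 0
  from continuous_on_fam_compose[OF this[unfolded Ck_fam.simps] assms(4)] show ?case by simp
next
  case (Suc k)
  have "Ck_fam k f S" using Suc.prems Ck_fam_SucD by blast
  then have "Ck_fam k (\<lambda>s x. frechet_derivative (g s) (at (f s x)) y) S" for y
    using Suc.IH[OF Ck_fam_frechet[OF Suc.prems(1)]] by blast
  then have "Ck_fam k (\<lambda>s x. frechet_derivative (g s) (at (f s x))
      (frechet_derivative (f s) (at x) h)) S" for h
    using Ck_fam_frechet[OF Suc.prems(2)] \<open>open S\<close>
    by (rule Ck_fam_linear_apply)
      (use Ck_fam_has_derivative[OF Suc.prems(1)] assms(4) in
        \<open>auto intro!: has_derivative_linear\<close>)
  moreover have "((\<lambda>x. g s (f s x)) has_derivative (\<lambda>h. frechet_derivative (g s) (at (f s x))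
      (frechet_derivative (f s) (at x) h))) (at x)" if "s \<in> {0..1}" "x \<in> S" for s x
    using has_derivative_compose[OF Ck_fam_has_derivative[OF Suc.prems(2) that]
        Ck_fam_has_derivative[OF Suc.prems(1) that(1) assms(4)[OF that]]] .
  ultimately show ?case
    using \<open>open S\<close> continuous_on_fam_compose[OF Ck_fam_continuous[OF Suc.prems(1)]
        Ck_fam_continuous[OF Suc.prems(2)]] assms(4)
    by (intro Ck_fam_SucI) auto
qed

section \<open>Gronwall's inequality and Picard iteration\<close>

lemma has_vector_derivative_imp_continuous_on:
  assumes "\<And>s. s \<in> T \<Longrightarrow> (u has_vector_derivative u' s) (at s within T)"
  shows "continuous_on T u"
  using assms has_vector_derivative_continuous continuous_on_eq_continuous_within by blast

lemma continuous_on_compact_norm_bound: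
  fixes f :: "'a::topological_space \<Rightarrow> 'b::real_normed_vector"
  assumes "compact S" "continuous_on S f"
  obtains B where "\<And>x. x \<in> S \<Longrightarrow> norm (f x) \<le> B"
proof -
  have "bounded (f ` S)"
    using assms by (intro compact_imp_bounded compact_continuous_image)
  then show thesis using that by (auto simp: bounded_iff)
qed

text \<open>
  Working with \<open>\<parallel>u\<parallel>\<^sup>2\<close> avoids differentiating the norm at zeros of \<open>u\<close>: from
  \<open>2 u \<bullet> u' \<le> 2 K \<parallel>u\<parallel>\<^sup>2 + 2 e \<parallel>u\<parallel> \<le> (2 K + 1) \<parallel>u\<parallel>\<^sup>2 + e\<^sup>2\<close> it follows that
  \<open>exp (- (2 K + 1) s) \<parallel>u s\<parallel>\<^sup>2 - e\<^sup>2 s\<close> is decreasing. Taking \<open>e = 0\<close> gives uniqueness of solutions.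
\<close>

lemma gronwall_zero:
  fixes u :: "real \<Rightarrow> 'b::real_inner"
  assumes "K \<ge> 0" "e \<ge> 0" "u 0 = 0"
    and u: "\<And>s. s \<in> {0..1} \<Longrightarrow> (u has_vector_derivative u' s) (at s within {0..1})"
    and bound: "\<And>s. s \<in> {0..1} \<Longrightarrow> norm (u' s) \<le> K * norm (u s) + e"
    and s: "s \<in> {0..1}"
  shows "norm (u s) \<le> e * exp (K + 1)"
proof -
  define g where "g s = exp (- (2 * K + 1) * s) * (u s \<bullet> u s) - e\<^sup>2 * s" for s
  have cont: "continuous_on {0..1} u"
    by (rule has_vector_derivative_imp_continuous_on[OF u])
  have "g s \<le> g 0"
  proof (cases "s = 0")
    case False
    show ?thesis
    proof (rule DERIV_nonpos_imp_decreasing_open[of 0 s g])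
      show "continuous_on {0..s} g"
        unfolding g_def using s by (intro continuous_intros continuous_on_subset[OF cont]) auto
      fix x assume x: "0 < x" "x < s"
      then have "(u has_vector_derivative u' x) (at x)"
        using u[of x] s at_within_Icc_at[of 0 x 1] by auto
      then have "((\<lambda>s. u s \<bullet> u s) has_real_derivative 2 * (u x \<bullet> u' x)) (at x)"
        unfolding has_vector_derivative_def has_field_derivative_def
        by (auto intro!: derivative_eq_intros simp: inner_commute)
      then have g': "(g has_real_derivative
          exp (- (2 * K + 1) * x) * (2 * (u x \<bullet> u' x) - (2 * K + 1) * (u x \<bullet> u x)) - e\<^sup>2) (at x)"
        unfolding g_def by (auto intro!: derivative_eq_intros simp: algebra_simps)
      have "u x \<bullet> u' x \<le> norm (u x) * norm (u' x)"
        by (rule norm_cauchy_schwarz)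
      also have "\<dots> \<le> norm (u x) * (K * norm (u x) + e)"
        using bound x s by (intro mult_left_mono) auto
      finally have "2 * (u x \<bullet> u' x) \<le> 2 * K * (norm (u x))\<^sup>2 + 2 * (norm (u x) * e)"
        by (simp add: power2_eq_square algebra_simps)
      moreover have "2 * (norm (u x) * e) \<le> (norm (u x))\<^sup>2 + e\<^sup>2"
        using sum_squares_bound[of "norm (u x)" e] by simp
      ultimately have "2 * (u x \<bullet> u' x) - (2 * K + 1) * (u x \<bullet> u x) \<le> e\<^sup>2"
        by (simp add: power2_norm_eq_inner algebra_simps)
      then have "exp (- (2 * K + 1) * x) * (2 * (u x \<bullet> u' x) - (2 * K + 1) * (u x \<bullet> u x))
          \<le> exp (- (2 * K + 1) * x) * e\<^sup>2"
        by (intro mult_left_mono) auto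
      also have "\<dots> \<le> 1 * e\<^sup>2"
      proof (intro mult_right_mono)
        have "(2 * K + 1) * x \<ge> 0" using x \<open>K \<ge> 0\<close> by simp
        then show "exp (- (2 * K + 1) * x) \<le> 1" by (simp only: exp_le_one_iff mult_minus_left neg_le_0_iff_le)
      qed simp
      finally have "exp (- (2 * K + 1) * x) * (2 * (u x \<bullet> u' x) - (2 * K + 1) * (u x \<bullet> u x)) \<le> e\<^sup>2"
        by simp
      then show "\<exists>y. DERIV g x :> y \<and> y \<le> 0"
        using g' by fastforce
    qed (use s False in auto)
  qed simp
  then have "exp (- (2 * K + 1) * s) * (norm (u s))\<^sup>2 \<le> e\<^sup>2 * s"
    by (simp add: g_def \<open>u 0 = 0\<close> power2_norm_eq_inner)
  also have "\<dots> \<le> e\<^sup>2"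
    using s by (simp add: mult_left_le)
  finally have "exp ((2 * K + 1) * s) * (exp (- (2 * K + 1) * s) * (norm (u s))\<^sup>2) \<le> exp ((2 * K + 1) * s) * e\<^sup>2"
    by (intro mult_left_mono) auto
  then have "(norm (u s))\<^sup>2 \<le> exp ((2 * K + 1) * s) * e\<^sup>2"
    by (simp only: mult.assoc[symmetric] exp_add[symmetric] mult_minus_left add.right_inverse
        exp_zero mult_1)
  also have "\<dots> \<le> exp (2 * (K + 1)) * e\<^sup>2"
  proof (intro mult_right_mono)
    have "(2 * K + 1) * s \<le> (2 * K + 1) * 1"
      using s \<open>K \<ge> 0\<close> by (intro mult_left_mono) auto
    then show "exp ((2 * K + 1) * s) \<le> exp (2 * (K + 1))" by simp
  qed simp
  also have "\<dots> = (e * exp (K + 1))\<^sup>2"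
    unfolding power_mult_distrib exp_double by (rule mult.commute)
  finally show ?thesis
    using \<open>e \<ge> 0\<close> by (simp add: power2_le_iff_abs_le)
qed

text \<open>
  The mean value inequality against the primitive of \<open>C \<bar>x - t0\<bar> ^ n\<close>, on either side of \<open>t0\<close>.
\<close>

lemma norm_bound_of_derivative_power_bound:
  fixes d :: "real \<Rightarrow> 'b::real_normed_vector"
  assumes "t0 \<in> {a..b}" "t \<in> {a..b}" "d t0 = 0"
    and d: "\<And>x. x \<in> {a..b} \<Longrightarrow> (d has_vector_derivative d' x) (at x within {a..b})"
    and bound: "\<And>x. x \<in> {a..b} \<Longrightarrow> norm (d' x) \<le> C * \<bar>x - t0\<bar> ^ n"
  shows "norm (d t) \<le> C * \<bar>t - t0\<bar> ^ Suc n / Suc n"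
proof -
  have cont: "continuous_on {a..b} d"
    by (rule has_vector_derivative_imp_continuous_on[OF d])
  have der: "(d has_vector_derivative d' x) (at x)" if "a < x" "x < b" for x
    using d[of x] that at_within_Icc_at[of a x b] by auto
  consider "t = t0" | "t0 < t" | "t < t0" by linarith
  then show ?thesis
  proof cases
    case 2
    define p where "p x = C * (x - t0) ^ Suc n / Suc n" for x
    have "norm (d t - d t0) \<le> p t - p t0"
    proof (rule differentiable_bound_general[OF 2])
      show "continuous_on {t0..t} d"
        using assms(1,2) by (auto intro: continuous_on_subset[OF cont])
      show "continuous_on {t0..t} p"
        unfolding p_def by (intro continuous_intros)  auto
      fix x assume x: "t0 < x" "x < t"
      show "(d has_vector_derivative d' x) (at x)"
        using x assms(1,2) by (intro der) auto
      show "(p has_vector_derivative C * (x - t0) ^ n) (at x)"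
        unfolding p_def has_real_derivative_iff_has_vector_derivative[symmetric]
        by (auto intro!: derivative_eq_intros simp del: of_nat_Suc power_Suc)
      show "norm (d' x) \<le> C * (x - t0) ^ n"
        using bound[of x] x assms(1,2) by auto
    qed
    with 2 \<open>d t0 = 0\<close> show ?thesis by (simp add: p_def)
  next
    case 3
    define p where "p x = - C * (t0 - x) ^ Suc n / Suc n" for x
    have "norm (d t0 - d t) \<le> p t0 - p t"
    proof (rule differentiable_bound_general[OF 3])
      show "continuous_on {t..t0} d"
        using assms(1,2) by (auto intro: continuous_on_subset[OF cont])
      show "continuous_on {t..t0} p"
        unfolding p_def by (intro continuous_intros)  auto
      fix x assume x: "t < x" "x < t0"
      show "(d has_vector_derivative d' x) (at x)"
        using x assms(1,2) by (intro der) auto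
      show "(p has_vector_derivative C * (t0 - x) ^ n) (at x)"
        unfolding p_def has_real_derivative_iff_has_vector_derivative[symmetric]
        by (auto intro!: derivative_eq_intros simp del: of_nat_Suc power_Suc)
      show "norm (d' x) \<le> C * (t0 - x) ^ n"
        using bound[of x] x assms(1,2) by auto
    qed
    with 3 \<open>d t0 = 0\<close> show ?thesis by (simp add: p_def)
  qed (simp add: \<open>d t0 = 0\<close>)
qed

text \<open>
  Successive Picard iterates differ by at most \<open>B (K \<bar>t - t0\<bar>) ^ n / n!\<close>, so that they converge
  uniformly on the whole interval, however large \<open>K\<close> is.
\<close>

lemma picard_lindelof_global:
  fixes f :: "real \<Rightarrow> 'b::banach \<Rightarrow> 'b"
  assumes t0: "t0 \<in> {a..b}" and "K \<ge> 0"
    and f: "continuous_on ({a..b} \<times> UNIV) (\<lambda>q. f (fst q) (snd q))"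
    and lip: "\<And>t y z. t \<in> {a..b} \<Longrightarrow> norm (f t y - f t z) \<le> K * norm (y - z)"
  obtains y where "y t0 = y0"
    and "\<And>t. t \<in> {a..b} \<Longrightarrow> (y has_vector_derivative f t (y t)) (at t within {a..b})"
proof -
  \<comment> \<open>The difference of two integrals from \<open>a\<close> plays the role of the oriented integral from \<open>t0\<close> to \<open>t\<close>.\<close>
  define J where "J g t = y0 + (integral {a..t} (\<lambda>s. f s (g s)) - integral {a..t0} (\<lambda>s. f s (g s)))"
    for g t
  have J_t0: "J g t0 = y0" for g by (simp add: J_def)
  have J_deriv: "(J g has_vector_derivative f t (g t)) (at t within {a..b})"
    if "continuous_on {a..b} g" "t \<in> {a..b}" for g t
  proof -
    have "continuous_on {a..b} (\<lambda>s. (s, g s))"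
      using that(1) by (intro continuous_intros)
    then have "continuous_on {a..b} (\<lambda>s. f s (g s))"
      using continuous_on_compose2[OF f] by force
    then show ?thesis
      unfolding J_def using that(2)
      by (auto intro!: derivative_eq_intros integral_has_vector_derivative)
  qed
  have J_cont: "continuous_on {a..b} (J g)" if "continuous_on {a..b} g" for g
    by (rule has_vector_derivative_imp_continuous_on[OF J_deriv[OF that]])
  define Y where "Y n = (J ^^ n) (\<lambda>_. y0)" for n
  have Y_cont: "continuous_on {a..b} (Y n)" for n
    by (induction n) (auto simp: Y_def J_cont)
  obtain B where B: "\<And>t. t \<in> {a..b} \<Longrightarrow> norm (Y 1 t - Y 0 t) \<le> B"
    by (rule continuous_on_compact_norm_bound[of "{a..b}" "\<lambda>t. Y 1 t - Y 0 t"])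
      (auto intro: continuous_on_diff Y_cont)
  have step: "norm (Y (Suc n) t - Y n t) \<le> B * K ^ n / fact n * \<bar>t - t0\<bar> ^ n"
    if "t \<in> {a..b}" for n t
    using that
  proof (induction n arbitrary: t)
    case 0
    then show ?case using B by simp
  next
    case (Suc n)
    have "norm (J (Y (Suc n)) t - J (Y n) t) \<le> K * (B * K ^ n / fact n) * \<bar>t - t0\<bar> ^ Suc n / Suc n"
    proof (rule norm_bound_of_derivative_power_bound[OF t0 Suc.prems,
          where d' = "\<lambda>t. f t (Y (Suc n) t) - f t (Y n t)"])
      fix x assume x: "x \<in> {a..b}"
      show "((\<lambda>t. J (Y (Suc n)) t - J (Y n) t) has_vector_derivative
          f x (Y (Suc n) x) - f x (Y n x)) (at x within {a..b})"
        using x by (intro has_vector_derivative_diff J_deriv Y_cont)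
      have "norm (f x (Y (Suc n) x) - f x (Y n x)) \<le> K * norm (Y (Suc n) x - Y n x)"
        using lip x by blast
      also have "\<dots> \<le> K * (B * K ^ n / fact n * \<bar>x - t0\<bar> ^ n)"
        using Suc.IH x \<open>K \<ge> 0\<close> by (intro mult_left_mono)
      finally show "norm (f x (Y (Suc n) x) - f x (Y n x)) \<le> K * (B * K ^ n / fact n) * \<bar>x - t0\<bar> ^ n"
        by (simp add: mult.assoc)
    qed (simp add: J_t0)
    then show ?case by (simp add: Y_def algebra_simps)
  qed
  have "uniform_limit {a..b} (\<lambda>n t. \<Sum>i<n. Y (Suc i) t - Y i t)
      (\<lambda>t. suminf (\<lambda>i. Y (Suc i) t - Y i t)) sequentially"
  proof (rule Weierstrass_m_test)
    fix n t assume t: "t \<in> {a..b}"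
    have "B \<ge> 0" using B[OF t0] norm_ge_zero order_trans by blast
    have "norm (Y (Suc n) t - Y n t) \<le> B * K ^ n / fact n * \<bar>t - t0\<bar> ^ n"
      using step t by blast
    also have "\<dots> \<le> B * K ^ n / fact n * (b - a) ^ n"
      using t t0 \<open>B \<ge> 0\<close> \<open>K \<ge> 0\<close> by (intro mult_left_mono power_mono) auto
    finally show "norm (Y (Suc n) t - Y n t) \<le> B * ((K * (b - a)) ^ n /\<^sub>R fact n)"
      by (simp add: power_mult_distrib divide_inverse mult_ac)
  qed (intro summable_mult summable_exp_generic)
  then have "uniform_limit {a..b} (\<lambda>n t. y0 + (\<Sum>i<n. Y (Suc i) t - Y i t))
      (\<lambda>t. y0 + suminf (\<lambda>i. Y (Suc i) t - Y i t)) sequentially"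
    by (intro uniform_limit_intros)
  moreover have "y0 + (\<Sum>i<n. Y (Suc i) t - Y i t) = Y n t" for n t
    by (subst sum_lessThan_telescope) (simp add: Y_def)
  ultimately obtain y where y: "uniform_limit {a..b} Y y sequentially" by auto
  have y_cont: "continuous_on {a..b} y"
    by (rule uniform_limit_theorem[OF _ y]) (auto simp: Y_cont)
  have fixpoint: "J y t = y t" if t: "t \<in> {a..b}" for t
  proof (rule LIMSEQ_unique)
    show "(\<lambda>n. Y (Suc n) t) \<longlonglongrightarrow> y t"
      using tendsto_uniform_limitI[OF y t] by (rule LIMSEQ_Suc)
    show "(\<lambda>n. Y (Suc n) t) \<longlonglongrightarrow> J y t"
    proof (rule LIMSEQ_I)
      fix e :: real assume "e > 0"
      define c where "c = e / (2 * (K * (b - a) + 1))"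
      have pos: "K * (b - a) + 1 > 0" using t0 \<open>K \<ge> 0\<close>
        by (intro add_nonneg_pos mult_nonneg_nonneg) auto
      then have "c > 0" using \<open>e > 0\<close> by (simp add: c_def)
      then obtain N where N: "\<And>n t. n \<ge> N \<Longrightarrow> t \<in> {a..b} \<Longrightarrow> norm (Y n t - y t) < c"
        using uniform_limitD[OF y] by (fastforce simp: eventually_sequentially dist_norm)
      have "norm (Y (Suc n) t - J y t) < e" if "n \<ge> N" for n
      proof -
        have "norm (J (Y n) t - J y t) \<le> (K * c) * \<bar>t - t0\<bar> ^ Suc 0 / Suc 0"
        proof (rule norm_bound_of_derivative_power_bound[OF t0 t,
              where d' = "\<lambda>t. f t (Y n t) - f t (y t)"])
          fix x assume x: "x \<in> {a..b}"
          show "((\<lambda>t. J (Y n) t - J y t) has_vector_derivative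
              f x (Y n x) - f x (y x)) (at x within {a..b})"
            using x by (intro has_vector_derivative_diff J_deriv Y_cont y_cont)
          have "norm (f x (Y n x) - f x (y x)) \<le> K * norm (Y n x - y x)"
            using lip x by blast
          also have "\<dots> \<le> K * c"
            using N[OF that x] \<open>K \<ge> 0\<close> by (intro mult_left_mono) auto
          finally show "norm (f x (Y n x) - f x (y x)) \<le> K * c * \<bar>x - t0\<bar> ^ 0" by simp
        qed (simp add: J_t0)
        also have "\<dots> \<le> K * c * (b - a)"
          using t t0 \<open>K \<ge> 0\<close> \<open>c > 0\<close> by (simp, intro mult_left_mono) auto
        also have "\<dots> \<le> (K * (b - a) + 1) * c"
          using \<open>c > 0\<close> by (simp add: algebra_simps)
        also have "\<dots> = e / 2"
        proof -
          have "D * (e / (2 * D)) = e / 2" if "D > 0" for D :: real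
            using that by simp
          from this[OF pos] show ?thesis by (simp only: c_def)
        qed
        also have "\<dots> < e" using \<open>e > 0\<close> by simp
        finally show ?thesis by (simp add: Y_def)
      qed
      then show "\<exists>N. \<forall>n\<ge>N. norm (Y (Suc n) t - J y t) < e" by blast
    qed
  qed
  show thesis
  proof
    show "y t0 = y0" using fixpoint[OF t0] J_t0 by simp
    show "(y has_vector_derivative f t (y t)) (at t within {a..b})" if "t \<in> {a..b}" for t
      using J_deriv[OF y_cont that] fixpoint that
      by (metis (no_types, lifting) has_vector_derivative_transform)
  qed
qed

section \<open>Smooth dependence on parameters\<close>

lemma continuous_on_along_curve:
  assumes "continuous_on (T \<times> D) (\<lambda>q. f (fst q) (snd q))"
    and "continuous_on T c" "\<And>s. s \<in> T \<Longrightarrow> c s \<in> D"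
  shows "continuous_on T (\<lambda>s. f s (c s))"
proof -
  have "continuous_on T (\<lambda>s. (s, c s))"
    by (intro continuous_intros assms(2))
  from continuous_on_compose2[OF assms(1) this] assms(3) show ?thesis
    by (auto simp: image_subset_iff)
qed

text \<open>
  A compact curve in an open set has a compact tubular neighbourhood inside that set, and a
  continuous function is uniformly continuous there.
\<close>

lemma uniform_along_curve:
  fixes f :: "real \<Rightarrow> 'a::euclidean_space \<Rightarrow> 'c::real_normed_vector"
  assumes "open D" "continuous_on ({0..1} \<times> D) (\<lambda>q. f (fst q) (snd q))"
    and c: "continuous_on {0..1} c" "\<And>s. s \<in> {0..1} \<Longrightarrow> c s \<in> D" and "e > 0"
  obtains d where "d > 0"
    and "\<And>s k. s \<in> {0..1} \<Longrightarrow> norm k \<le> d \<Longrightarrow>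
      c s + k \<in> D \<and> norm (f s (c s + k) - f s (c s)) < e"
proof -
  have "compact (c ` {0..1})" "c ` {0..1} \<subseteq> D"
    using c by (auto intro: compact_continuous_image)
  then obtain r where r: "r > 0" "(\<Union>x\<in>c ` {0..1}. ball x r) \<subseteq> D"
    using compact_subset_open_imp_ball_epsilon_subset \<open>open D\<close> by metis
  have tube: "c s + k \<in> D" if "s \<in> {0..1}" "norm k < r" for s k
    using r(2) that by (force simp: dist_norm)
  define T where "T = {0..1::real} \<times> cball (0::'a) (r/2)"
  have "continuous_on T (\<lambda>q. (fst q, c (fst q) + snd q))"
    unfolding T_def by (intro continuous_intros continuous_on_compose2[OF c(1)]) auto
  then have "continuous_on T (\<lambda>q. f (fst q) (c (fst q) + snd q))"
    using continuous_on_compose2[OF assms(2), of T "\<lambda>q. (fst q, c (fst q) + snd q)"] tube r(1)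
    by (auto simp: T_def image_subset_iff)
  moreover have "compact T"
    unfolding T_def by (intro compact_Times) auto
  ultimately have "uniformly_continuous_on T (\<lambda>q. f (fst q) (c (fst q) + snd q))"
    by (rule compact_uniformly_continuous)
  then obtain d where d: "d > 0" "\<And>q q'. q \<in> T \<Longrightarrow> q' \<in> T \<Longrightarrow> dist q' q < d \<Longrightarrow>
      dist (f (fst q') (c (fst q') + snd q')) (f (fst q) (c (fst q) + snd q)) < e"
    using \<open>e > 0\<close> unfolding uniformly_continuous_on_def by metis
  show thesis
  proof
    show "min (r/2) (d/2) > 0" using d r by simp
    fix s and k :: 'a assume "s \<in> {0..1::real}" "norm k \<le> min (r/2) (d/2)"
    then show "c s + k \<in> D \<and> norm (f s (c s + k) - f s (c s)) < e"
      using tube[of s k] d(2)[of "(s, 0)" "(s, k)"] d(1) r(1)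
      by (auto simp: T_def dist_Pair_Pair dist_norm)
  qed
qed

lemma norm_linear_le_sum_Basis:
  fixes l :: "'a::euclidean_space \<Rightarrow> 'b::real_normed_vector"
  assumes "linear l"
  shows "norm (l k) \<le> (\<Sum>i\<in>Basis. norm (l i)) * norm k"
proof -
  have "norm (l k) \<le> (\<Sum>i\<in>Basis. norm ((k \<bullet> i) *\<^sub>R l i))"
    by (subst linear_basis_sum[OF assms]) (rule norm_sum)
  also have "\<dots> \<le> (\<Sum>i\<in>Basis. norm (l i) * norm k)"
    by (intro sum_mono) (simp add: mult.commute[of "norm (l _)"] mult_right_mono Basis_le_norm)
  finally show ?thesis by (simp add: sum_distrib_right)
qed

text \<open>
  First-order expansion with an error that is uniform along a compact curve, obtained from the
  mean value inequality and the uniform continuity of the derivative near the curve.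
\<close>

lemma uniformly_differentiable_along_curve:
  fixes f :: "real \<Rightarrow> 'a::euclidean_space \<Rightarrow> 'b::euclidean_space"
  assumes "open D" and f: "Ck_fam (Suc 0) f D"
    and c: "continuous_on {0..1} c" "\<And>s. s \<in> {0..1} \<Longrightarrow> c s \<in> D" and "e > 0"
  obtains d where "d > 0"
    and "\<And>s k. s \<in> {0..1} \<Longrightarrow> norm k \<le> d \<Longrightarrow> c s + k \<in> D \<and>
      norm (f s (c s + k) - f s (c s) - frechet_derivative (f s) (at (c s)) k) \<le> e * norm k"
proof -
  define f' where "f' s x = frechet_derivative (f s) (at x)" for s x
  have f'_cont: "continuous_on ({0..1} \<times> D) (\<lambda>q. f' (fst q) (snd q) h)" for h
    using f by (simp add: f'_def)
  have der: "(f s has_derivative f' s x) (at x)" if "s \<in> {0..1}" "x \<in> D" for s x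
    using Ck_fam_has_derivative[OF f that] by (simp add: f'_def)
  \<comment> \<open>This dominates the operator norm of \<open>f' s x - f' s (c s)\<close> and vanishes on the curve.\<close>
  define g where "g s x = (\<Sum>i\<in>Basis. norm (f' s x i - f' s (c s) i))" for s x
  have "continuous_on ({0..1} \<times> D) (\<lambda>q. f' (fst q) (c (fst q)) i)" for i
    using continuous_on_along_curve[OF f'_cont c]
    by (rule continuous_on_compose2) (auto intro: continuous_intros)
  then have "continuous_on ({0..1} \<times> D) (\<lambda>q. g (fst q) (snd q))"
    unfolding g_def by (intro continuous_intros f'_cont)
  from uniform_along_curve[OF \<open>open D\<close> this c \<open>e > 0\<close>] obtain d where d: "d > 0"
    "\<And>s k. s \<in> {0..1} \<Longrightarrow> norm (k :: 'a) \<le> d \<Longrightarrow> c s + k \<in> D \<and> norm (g s (c s + k) - g s (c s)) < e"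
    by blast
  show thesis
  proof
    show "d > 0" by fact
    fix s and k :: 'a assume s: "s \<in> {0..1::real}" and k: "norm k \<le> d"
    have "norm (f s (c s + k) - f s (c s) - f' s (c s) (c s + k - c s)) \<le> norm (c s + k - c s) * e"
    proof (rule differentiable_bound_linearization[where S = "cball (c s) d"])
      fix t assume "t \<in> {0..1::real}"
      then have "\<bar>t\<bar> * norm k \<le> d"
        using k by (intro order_trans[OF _ k] mult_left_le_one_le) auto
      then show "c s + t *\<^sub>R (c s + k - c s) \<in> cball (c s) d"
        by (simp add: dist_norm)
    next
      fix x assume "x \<in> cball (c s) d"
      then have x: "x \<in> D" "norm (g s x - g s (c s)) < e"
        using d(2)[OF s, of "x - c s"] by (simp_all add: dist_norm norm_minus_commute)
      show "(f s has_derivative f' s x) (at x within cball (c s) d)"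
        using der[OF s x(1)] by (rule has_derivative_at_withinI)
      have "linear (\<lambda>k. f' s x k - f' s (c s) k)"
        using der[OF s x(1)] der[OF s c(2)[OF s]]
        by (intro linear_compose_sub has_derivative_linear)
      then have "norm (f' s x k - f' s (c s) k) \<le> e * norm k" for k
        using norm_linear_le_sum_Basis[of "\<lambda>k. f' s x k - f' s (c s) k" k] x(2)
        by (auto simp: g_def intro!: order_trans[OF _ mult_right_mono[of _ e]])
      then show "onorm (f' s x - f' s (c s)) \<le> e"
        using \<open>e > 0\<close> by (intro onorm_le) (auto simp: fun_diff_def)
    qed (use d in auto)
    then show "c s + k \<in> D \<and>
        norm (f s (c s + k) - f s (c s) - frechet_derivative (f s) (at (c s)) k) \<le> e * norm k"
      using d(2)[OF s k] by (simp add: f'_def mult.commute)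
  qed
qed

text \<open>
  An initial value problem \<open>y' = F s (p, y)\<close>, \<open>y 0 = 0\<close> on \<open>[0,1]\<close> depending on a parameter \<open>p\<close>, with
  \<open>Y s p\<close> its solution. Having all solutions start at \<open>0\<close> loses nothing, because initial values
  can be absorbed into \<open>F\<close>, and it makes the class of problems stable under differentiation in \<open>p\<close>:
  the derivative of \<open>Y\<close> in a fixed direction again starts at \<open>0\<close>. The Lipschitz constant is uniform
  over everything in \<open>D\<close> above a neighbourhood of \<open>p\<close>. Hence a nearby solution can be compared with the one at \<open>p\<close>
  without first showing that it stays close.
\<close>

locale parametric_ode =
  fixes F :: "real \<Rightarrow> 'p::euclidean_space \<times> 'b::euclidean_space \<Rightarrow> 'b"
    and P :: "'p set" and D :: "('p \<times> 'b) set" and Y :: "real \<Rightarrow> 'p \<Rightarrow> 'b"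
  assumes open_P: "open P" and open_D: "open D"
    and F_continuous: "continuous_on ({0..1} \<times> D) (\<lambda>q. F (fst q) (snd q))"
    and lipschitz: "\<And>p. p \<in> P \<Longrightarrow> \<exists>K\<ge>0. \<exists>d>0. \<forall>p'\<in>ball p d. \<forall>s\<in>{0..1}. \<forall>y z.
      (p', y) \<in> D \<longrightarrow> (p', z) \<in> D \<longrightarrow> norm (F s (p', y) - F s (p', z)) \<le> K * norm (y - z)"
    and in_D: "\<And>s p. s \<in> {0..1} \<Longrightarrow> p \<in> P \<Longrightarrow> (p, Y s p) \<in> D"
    and init: "\<And>p. p \<in> P \<Longrightarrow> Y 0 p = 0"
    and ode: "\<And>s p. s \<in> {0..1} \<Longrightarrow> p \<in> P \<Longrightarrow>
      ((\<lambda>s. Y s p) has_vector_derivative F s (p, Y s p)) (at s within {0..1})"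
begin

lemma curve_continuous:
  assumes "p \<in> P"
  shows "continuous_on {0..1} (\<lambda>s. Y s p)" "continuous_on {0..1} (\<lambda>s. (p, Y s p))"
proof -
  show "continuous_on {0..1} (\<lambda>s. Y s p)"
    by (rule has_vector_derivative_imp_continuous_on[OF ode]) (use assms in auto)
  then show "continuous_on {0..1} (\<lambda>s. (p, Y s p))"
    by (intro continuous_intros)
qed

lemma uniformly_close:
  assumes p: "p \<in> P" and "e > 0"
  obtains d where "d > 0"
    and "\<And>h. norm h < d \<Longrightarrow> p + h \<in> P"
    and "\<And>s h. s \<in> {0..1} \<Longrightarrow> norm h < d \<Longrightarrow> norm (Y s (p + h) - Y s p) \<le> e"
proof -
  obtain K d1 where K: "K \<ge> 0" "d1 > 0" "\<And>p' s y z. p' \<in> ball p d1 \<Longrightarrow> s \<in> {0..1} \<Longrightarrow>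
      (p', y) \<in> D \<Longrightarrow> (p', z) \<in> D \<Longrightarrow> norm (F s (p', y) - F s (p', z)) \<le> K * norm (y - z)"
    using lipschitz[OF p] by blast
  obtain d2 where d2: "d2 > 0" "ball p d2 \<subseteq> P"
    using open_P p open_contains_ball by blast
  \<comment> \<open>Gronwall's inequality costs a factor \<open>exp (K + 1)\<close>.\<close>
  define e' where "e' = e / exp (K + 1)"
  have "e' > 0" using \<open>e > 0\<close> by (simp add: e'_def)
  obtain d3 where d3: "d3 > 0" "\<And>s k. s \<in> {0..1} \<Longrightarrow> norm k \<le> d3 \<Longrightarrow>
      (p, Y s p) + k \<in> D \<and> norm (F s ((p, Y s p) + k) - F s (p, Y s p)) < e'"
    using uniform_along_curve[OF open_D F_continuous curve_continuous(2)[OF p] in_D[OF _ p] \<open>e' > 0\<close>]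
    by blast
  show thesis
  proof
    show "Min {d1, d2, d3} > 0" using K d2 d3 by simp
    show inP: "p + h \<in> P" if "norm h < Min {d1, d2, d3}" for h :: 'p
      using that d2(2) by (force simp: dist_norm)
    fix s and h :: 'p assume s: "s \<in> {0..1::real}" and h: "norm h < Min {d1, d2, d3}"
    have "norm (Y s (p + h) - Y s p) \<le> e' * exp (K + 1)"
    proof (rule gronwall_zero[where u' = "\<lambda>s. F s (p + h, Y s (p + h)) - F s (p, Y s p)"])
      fix s assume s: "s \<in> {0..1::real}"
      show "((\<lambda>s. Y s (p + h) - Y s p) has_vector_derivative
          F s (p + h, Y s (p + h)) - F s (p, Y s p)) (at s within {0..1})"
        using s p inP[OF h] by (intro has_vector_derivative_diff ode)
      have near: "(p + h, Y s p) \<in> D" "norm (F s (p + h, Y s p) - F s (p, Y s p)) < e'"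
        using d3(2)[OF s, of "(h, 0)"] h by (simp_all add: norm_Pair)
      have "norm (F s (p + h, Y s (p + h)) - F s (p + h, Y s p)) \<le> K * norm (Y s (p + h) - Y s p)"
        using K(3)[OF _ s in_D[OF s inP[OF h]] near(1)] h by (simp add: dist_norm)
      then show "norm (F s (p + h, Y s (p + h)) - F s (p, Y s p)) \<le> K * norm (Y s (p + h) - Y s p) + e'"
        using near(2) norm_triangle_le_diff
          norm_diff_triangle_ineq[of "F s (p + h, Y s (p + h))" "F s (p + h, Y s p)"]
        by (smt (verit) norm_triangle_ineq4 norm_diff_triangle_le)
    qed (use s K \<open>e' > 0\<close> init p inP[OF h] in auto)
    then show "norm (Y s (p + h) - Y s p) \<le> e" by (simp add: e'_def)
  qed
qed

lemma solution_continuous: "continuous_on ({0..1} \<times> P) (\<lambda>q. Y (fst q) (snd q))"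
  unfolding continuous_on_iff
proof safe
  fix s :: real and p and e :: real assume s: "s \<in> {0..1}" and p: "p \<in> P" and "0 < e"
  obtain d1 where d1: "d1 > 0"
    "\<And>s h. s \<in> {0..1} \<Longrightarrow> norm h < d1 \<Longrightarrow> norm (Y s (p + h) - Y s p) \<le> e / 2"
    using uniformly_close[OF p, of "e / 2"] \<open>0 < e\<close> by (metis half_gt_zero)
  obtain d2 where d2: "d2 > 0"
    "\<And>s' :: real. s' \<in> {0..1} \<Longrightarrow> dist s' s < d2 \<Longrightarrow> dist (Y s' p) (Y s p) < e / 2"
    using curve_continuous(1)[OF p] s \<open>0 < e\<close> unfolding continuous_on_iff by (metis half_gt_zero)
  show "\<exists>d>0. \<forall>x'\<in>{0..1} \<times> P. dist x' (s, p) < d \<longrightarrow>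
      dist (Y (fst x') (snd x')) (Y (fst (s, p)) (snd (s, p))) < e"
  proof (intro exI conjI ballI impI)
    show "min d1 d2 > 0" using d1 d2 by simp
    fix x' assume x': "x' \<in> {0..1} \<times> P" "dist x' (s, p) < min d1 d2"
    have "dist (fst x') s < d2" "dist (snd x') p < d1"
      using x'(2) dist_fst_le[of x' "(s, p)"] dist_snd_le[of x' "(s, p)"] by auto
    then have "dist (Y (fst x') p) (Y s p) < e / 2" "dist (Y (fst x') (snd x')) (Y (fst x') p) \<le> e / 2"
      using x'(1) d2(2)[of "fst x'"] d1(2)[of "fst x'" "snd x' - p"] by (auto simp: dist_norm)
    then show "dist (Y (fst x') (snd x')) (Y (fst (s, p)) (snd (s, p))) < e"
      using dist_triangle[of "Y (fst x') (snd x')" "Y s p" "Y (fst x') p"] by simp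
  qed
qed

text \<open>
  The derivative in \<open>p\<close> satisfies the variational equation. With \<open>\<Delta> = Y (p + h) - Y p\<close>, the
  first-order expansion of \<open>F\<close> along the curve \<open>(p, Y s p)\<close> gives \<open>\<Delta>' = F' (h, \<Delta>) + R\<close>
  with \<open>\<parallel>R\<parallel> \<le> \<eta> (\<parallel>h\<parallel> + \<parallel>\<Delta>\<parallel>)\<close>. A first use of Gronwall's inequality bounds \<open>\<Delta>\<close> by a multiple of \<open>\<parallel>h\<parallel>\<close>;
  a second one, for \<open>\<Delta> - W h\<close>, bounds that difference by a multiple of \<open>\<eta> \<parallel>h\<parallel>\<close>.
\<close>

lemma has_derivative_solution:
  assumes F: "Ck_fam (Suc 0) F D" and p: "p \<in> P" and "s \<in> {0..1}"
    and W0: "\<And>h. W h 0 = 0"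
    and W: "\<And>h s. s \<in> {0..1} \<Longrightarrow> (W h has_vector_derivative
      frechet_derivative (F s) (at (p, Y s p)) (h, W h s)) (at s within {0..1})"
  shows "(Y s has_derivative (\<lambda>h. W h s)) (at p)"
proof -
  define F' where "F' s = frechet_derivative (F s) (at (p, Y s p))" for s
  have F'_linear: "linear (F' s)" if "s \<in> {0..1}" for s
    using Ck_fam_has_derivative[OF F that in_D[OF that p]] has_derivative_linear
    unfolding F'_def by blast
  note W = W[folded F'_def]
  have "continuous_on {0..1} (\<lambda>s. F' s k)" for k
    unfolding F'_def using Ck_fam_continuous[OF Ck_fam_frechet[OF F]] curve_continuous(2)[OF p] in_D[OF _ p]
    by (rule continuous_on_along_curve)
  then have "continuous_on {0..1} (\<lambda>s. \<Sum>i\<in>Basis. norm (F' s i))"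
    by (intro continuous_intros)
  then obtain C where C: "\<And>s. s \<in> {0..1} \<Longrightarrow> norm (\<Sum>i\<in>Basis. norm (F' s i)) \<le> C"
    using continuous_on_compact_norm_bound[OF compact_Icc] by blast
  have F'_le: "norm (F' s k) \<le> C * norm k" if "s \<in> {0..1}" for s k
    using norm_linear_le_sum_Basis[OF F'_linear[OF that], of k] C[OF that]
    by (auto intro: order_trans[OF _ mult_right_mono])
  have "C \<ge> 0" using C[OF \<open>s \<in> {0..1}\<close>] norm_ge_zero order_trans by blast
  have unique: "u s = 0" if "u 0 = 0"
    "\<And>s. s \<in> {0..1} \<Longrightarrow> (u has_vector_derivative F' s (0, u s)) (at s within {0..1})" for u
    using gronwall_zero[of C 0 u "\<lambda>s. F' s (0, u s)" s] F'_le[of _ "(0, u _)"] that \<open>C \<ge> 0\<close>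
      \<open>s \<in> {0..1}\<close> by (auto simp: norm_Pair)
  have lin: "linear (\<lambda>h. W h s)"
  proof (rule linearI)
    fix h h'
    have "W (h + h') s - W h s - W h' s = 0"
    proof (rule unique[where u = "\<lambda>s. W (h + h') s - W h s - W h' s"])
      fix s assume s: "s \<in> {0..1::real}"
      have "F' s (0, W (h + h') s - W h s - W h' s) = F' s (h + h', W (h + h') s) - F' s (h, W h s) - F' s (h', W h' s)"
        by (simp flip: linear_diff[OF F'_linear[OF s]])
      then show "((\<lambda>s. W (h + h') s - W h s - W h' s) has_vector_derivative
          F' s (0, W (h + h') s - W h s - W h' s)) (at s within {0..1})"
        using s by (auto intro!: has_vector_derivative_diff W)
    qed (simp_all add: W0)
    then show "W (h + h') s = W h s + W h' s" by (simp add: algebra_simps)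
  next
    fix r h
    have "W (r *\<^sub>R h) s - r *\<^sub>R W h s = 0"
    proof (rule unique[where u = "\<lambda>s. W (r *\<^sub>R h) s - r *\<^sub>R W h s"])
      fix s assume s: "s \<in> {0..1::real}"
      have "F' s (0, W (r *\<^sub>R h) s - r *\<^sub>R W h s) = F' s (r *\<^sub>R h, W (r *\<^sub>R h) s) - r *\<^sub>R F' s (h, W h s)"
        by (simp flip: linear_diff[OF F'_linear[OF s]] linear_scale[OF F'_linear[OF s]])
      then show "((\<lambda>s. W (r *\<^sub>R h) s - r *\<^sub>R W h s) has_vector_derivative
          F' s (0, W (r *\<^sub>R h) s - r *\<^sub>R W h s)) (at s within {0..1})"
        using s by (auto intro!: derivative_eq_intros W)
    qed (simp_all add: W0)
    then show "W (r *\<^sub>R h) s = r *\<^sub>R W h s" by simp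
  qed
  show ?thesis
    unfolding has_derivative_at_alt
  proof (intro conjI allI impI)
    show "bounded_linear (\<lambda>h. W h s)" using lin by (rule linear_conv_bounded_linear[THEN iffD1])
    fix e :: real assume "e > 0"
    \<comment> \<open>\<open>C2\<close> is the constant in \<open>\<parallel>\<Delta>\<parallel> \<le> C2 \<parallel>h\<parallel>\<close>, and \<open>\<eta> c\<close> the one in the final bound.\<close>
    define C2 where "C2 = (C + 1) * exp (C + 2)"
    define c where "c = (1 + C2) * exp (C + 1)"
    have "C2 \<ge> 0" "c > 0" using \<open>C \<ge> 0\<close> by (simp_all add: C2_def c_def add_pos_nonneg)
    define \<eta> where "\<eta> = min 1 (e / c)"
    have \<eta>: "0 < \<eta>" "\<eta> \<le> 1" "\<eta> * c \<le> e"
      using \<open>e > 0\<close> \<open>c > 0\<close> by (auto simp: \<eta>_def min_def field_simps)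
    obtain d1 where d1: "d1 > 0" "\<And>s k. s \<in> {0..1} \<Longrightarrow> norm k \<le> d1 \<Longrightarrow>
        norm (F s ((p, Y s p) + k) - F s (p, Y s p) - F' s k) \<le> \<eta> * norm k"
      using uniformly_differentiable_along_curve[OF open_D F curve_continuous(2)[OF p]
          in_D[OF _ p] \<eta>(1)] unfolding F'_def by metis
    obtain d2 where d2: "d2 > 0" "\<And>h. norm h < d2 \<Longrightarrow> p + h \<in> P"
      "\<And>s h. s \<in> {0..1} \<Longrightarrow> norm h < d2 \<Longrightarrow> norm (Y s (p + h) - Y s p) \<le> d1 / 2"
      using uniformly_close[OF p, of "d1 / 2"] d1(1) by (metis half_gt_zero)
    show "\<exists>d>0. \<forall>y. norm (y - p) < d \<longrightarrow> norm (Y s y - Y s p - W (y - p) s) \<le> e * norm (y - p)"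
    proof (intro exI conjI allI impI)
      show "min (d1 / 2) d2 > 0" using d1 d2 by simp
      fix y assume "norm (y - p) < min (d1 / 2) d2"
      define h where "h = y - p"
      have h: "norm h < d1 / 2" "norm h < d2" "p + h \<in> P" "p + h = y"
        using \<open>norm (y - p) < _\<close> d2(2)[of h] by (auto simp: h_def)
      define \<Delta> where "\<Delta> s = Y s (p + h) - Y s p" for s
      define R where "R s = F s (p + h, Y s (p + h)) - F s (p, Y s p) - F' s (h, \<Delta> s)" for s
      have R: "norm (R s) \<le> \<eta> * (norm h + norm (\<Delta> s))" if "s \<in> {0..1}" for s
      proof -
        have le: "norm (h, \<Delta> s) \<le> norm h + norm (\<Delta> s)" by (rule norm_Pair_le)
        also have "\<dots> \<le> d1" using h d2(3)[OF that, of h] by (simp add: \<Delta>_def)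
        finally have "norm (R s) \<le> \<eta> * norm (h, \<Delta> s)"
          using d1(2)[OF that, of "(h, \<Delta> s)"] by (simp add: R_def \<Delta>_def)
        with le \<eta>(1) show ?thesis by (meson mult_left_mono order_trans less_imp_le)
      qed
      have \<Delta>_ode: "(\<Delta> has_vector_derivative F' s (h, \<Delta> s) + R s) (at s within {0..1})"
        if "s \<in> {0..1}" for s
        unfolding \<Delta>_def using that h p by (auto intro!: derivative_eq_intros ode simp: R_def \<Delta>_def)
      have \<Delta>_le: "norm (\<Delta> s) \<le> C2 * norm h" if "s \<in> {0..1}" for s
      proof -
        have "norm (\<Delta> s) \<le> (C + 1) * norm h * exp (C + 1 + 1)"
        proof (rule gronwall_zero[OF _ _ _ \<Delta>_ode])
          fix s assume s: "s \<in> {0..1::real}"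
          have "norm (F' s (h, \<Delta> s)) \<le> C * (norm h + norm (\<Delta> s))"
            using F'_le[OF s, of "(h, \<Delta> s)"] norm_Pair_le[of h "\<Delta> s"] \<open>C \<ge> 0\<close>
            by (meson mult_left_mono order_trans)
          moreover have "norm (R s) \<le> 1 * (norm h + norm (\<Delta> s))"
            using R[OF s] \<eta>(2) by (meson add_nonneg_nonneg mult_right_mono norm_ge_zero order_trans)
          ultimately show "norm (F' s (h, \<Delta> s) + R s) \<le> (C + 1) * norm (\<Delta> s) + (C + 1) * norm h"
            using norm_triangle_ineq[of "F' s (h, \<Delta> s)" "R s"] by (simp add: algebra_simps)
        qed (use that \<open>C \<ge> 0\<close> init p h in \<open>auto simp: \<Delta>_def\<close>)
        then show ?thesis by (simp add: C2_def ac_simps)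
      qed
      have "norm (\<Delta> s - W h s) \<le> (\<eta> * (1 + C2) * norm h) * exp (C + 1)"
      proof (rule gronwall_zero[where u' = "\<lambda>s. F' s (h, \<Delta> s) + R s - F' s (h, W h s)"])
        fix s assume s: "s \<in> {0..1::real}"
        show "((\<lambda>s. \<Delta> s - W h s) has_vector_derivative
            F' s (h, \<Delta> s) + R s - F' s (h, W h s)) (at s within {0..1})"
          using s by (intro has_vector_derivative_diff \<Delta>_ode W)
        have eq: "F' s (h, \<Delta> s) + R s - F' s (h, W h s) = F' s (0, \<Delta> s - W h s) + R s"
          using linear_diff[OF F'_linear[OF s], of "(h, \<Delta> s)" "(h, W h s)"] by simp
        have "norm (F' s (0, \<Delta> s - W h s)) \<le> C * norm (\<Delta> s - W h s)"
          using F'_le[OF s, of "(0, \<Delta> s - W h s)"] by (simp add: norm_Pair)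
        moreover have "norm (R s) \<le> \<eta> * (1 + C2) * norm h"
        proof -
          have "\<eta> * (norm h + norm (\<Delta> s)) \<le> \<eta> * (norm h + C2 * norm h)"
            using \<Delta>_le[OF s] \<eta>(1) by (intro mult_left_mono) auto
          with R[OF s] show ?thesis by (simp add: algebra_simps)
        qed
        ultimately show "norm (F' s (h, \<Delta> s) + R s - F' s (h, W h s))
            \<le> C * norm (\<Delta> s - W h s) + \<eta> * (1 + C2) * norm h"
          unfolding eq using norm_triangle_ineq[of "F' s (0, \<Delta> s - W h s)" "R s"] by linarith
      qed (use \<open>s \<in> {0..1}\<close> \<open>C \<ge> 0\<close> \<open>C2 \<ge> 0\<close> \<eta> init p h W0 in \<open>auto simp: \<Delta>_def\<close>)
      also have "\<dots> = \<eta> * c * norm h" by (simp add: c_def)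
      also have "\<dots> \<le> e * norm h" using \<eta>(3) by (intro mult_right_mono) auto
      finally show "norm (Y s y - Y s p - W (y - p) s) \<le> e * norm (y - p)"
        using h(4) by (simp add: \<Delta>_def h_def)
    qed
  qed
qed

end

text \<open>
  For linear equations the Lipschitz constant is an operator norm and holds on the whole state space,
  so that solutions exist on all of \<open>[0,1]\<close>.
\<close>

lemma linear_parametric_ode_exists:
  fixes A :: "real \<Rightarrow> 'p::euclidean_space \<Rightarrow> 'b::euclidean_space \<Rightarrow> 'b" and b :: "real \<Rightarrow> 'p \<Rightarrow> 'b"
  assumes "open P" and A: "\<And>y. Ck_fam k (\<lambda>s p. A s p y) P"
    and A_linear: "\<And>s p. s \<in> {0..1} \<Longrightarrow> p \<in> P \<Longrightarrow> linear (A s p)"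
    and b: "Ck_fam k b P"
  defines "F \<equiv> \<lambda>s q. A s (fst q) (snd q) + b s (fst q)"
  obtains W where "parametric_ode F P (P \<times> UNIV) W" and "Ck_fam k F (P \<times> UNIV)"
proof -
  have open_D: "open (P \<times> (UNIV :: 'b set))"
    using \<open>open P\<close> by (intro open_Times) auto
  have fst: "Ck_fam k (\<lambda>s. fst) (P \<times> (UNIV :: 'b set))"
    and snd: "Ck_fam k (\<lambda>s. snd) (P \<times> (UNIV :: 'b set))"
    by (intro Ck_fam_linear open_D bounded_linear_fst bounded_linear_snd)+
  have "Ck_fam k (\<lambda>s q. A s (fst q) y) (P \<times> (UNIV :: 'b set))" for y
    using Ck_fam_compose[OF A fst open_D] by auto
  then have "Ck_fam k (\<lambda>s q. A s (fst q) (snd q)) (P \<times> (UNIV :: 'b set))"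
    by (rule Ck_fam_linear_apply[OF _ snd open_D]) (auto intro: A_linear)
  moreover have "Ck_fam k (\<lambda>s q. b s (fst q)) (P \<times> (UNIV :: 'b set))"
    using Ck_fam_compose[OF b fst open_D] by auto
  ultimately have F: "Ck_fam k F (P \<times> UNIV)"
    unfolding F_def using open_D by (rule Ck_fam_add)
  have F_cont: "continuous_on ({0..1} \<times> (P \<times> UNIV)) (\<lambda>q. F (fst q) (snd q))"
    using F by (rule Ck_fam_continuous)
  have lip: "\<exists>K\<ge>0. \<exists>d>0. \<forall>p'\<in>ball p d. \<forall>s\<in>{0..1}. \<forall>y z.
      norm (F s (p', y) - F s (p', z)) \<le> K * norm (y - z)" if "p \<in> P" for p
  proof -
    obtain d where d: "d > 0" "cball p d \<subseteq> P"
      using \<open>open P\<close> \<open>p \<in> P\<close> open_contains_cball by blast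
    have "continuous_on ({0..1} \<times> cball p d) (\<lambda>q. \<Sum>i\<in>Basis. norm (A (fst q) (snd q) i))"
      using d(2) by (intro continuous_intros continuous_on_subset[OF Ck_fam_continuous[OF A]]) auto
    then obtain K where K: "\<And>q. q \<in> {0..1} \<times> cball p d \<Longrightarrow>
        norm (\<Sum>i\<in>Basis. norm (A (fst q) (snd q) i)) \<le> K"
      using continuous_on_compact_norm_bound[OF compact_Times[OF compact_Icc compact_cball]] by blast
    have "norm (\<Sum>i\<in>Basis. norm (A 0 p i)) \<le> K"
      using K[of "(0, p)"] d(1) by simp
    then have "K \<ge> 0" using norm_ge_zero order_trans by blast
    moreover have "norm (F s (p', y) - F s (p', z)) \<le> K * norm (y - z)"
      if "p' \<in> ball p d" "s \<in> {0..1}" for p' s y z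
    proof -
      have p': "p' \<in> P" using that(1) d(2) by auto
      have "norm (A s p' (y - z)) \<le> (\<Sum>i\<in>Basis. norm (A s p' i)) * norm (y - z)"
        using A_linear[OF that(2) p'] by (rule norm_linear_le_sum_Basis)
      also have "\<dots> \<le> K * norm (y - z)"
        using K[of "(s, p')"] that by (intro mult_right_mono) auto
      finally show ?thesis
        by (simp add: F_def linear_diff[OF A_linear[OF that(2) p']])
    qed
    ultimately show ?thesis using d(1) by blast
  qed
  have "\<exists>w. w 0 = 0 \<and> (\<forall>s\<in>{0..1}. (w has_vector_derivative F s (p, w s)) (at s within {0..1}))"
    if p: "p \<in> P" for p
  proof -
    obtain K where K: "K \<ge> 0"
      "\<And>s y z. s \<in> {0..1} \<Longrightarrow> norm (F s (p, y) - F s (p, z)) \<le> K * norm (y - z)"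
      using lip[OF p] by (meson centre_in_ball)
    have "continuous_on ({0..1} \<times> UNIV) (\<lambda>q::real \<times> 'b. (fst q, (p, snd q)))"
      by (intro continuous_intros)
    then have "continuous_on ({0..1} \<times> UNIV) (\<lambda>q. F (fst q) (p, snd q))"
      by (rule continuous_on_compose2[OF F_cont, of _ "\<lambda>q. (fst q, (p, snd q))", simplified]) (use p in auto)
    from picard_lindelof_global[of 0 0 1 K "\<lambda>s y. F s (p, y)", OF _ K(1) this K(2)]
    show ?thesis by (metis atLeastAtMost_iff order_refl zero_le_one)
  qed
  then obtain w where w: "\<And>p. p \<in> P \<Longrightarrow> w p 0 = 0" "\<And>p s. p \<in> P \<Longrightarrow> s \<in> {0..1} \<Longrightarrow>
      (w p has_vector_derivative F s (p, w p s)) (at s within {0..1})"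
    by metis
  have lip': "\<exists>K\<ge>0. \<exists>d>0. \<forall>p'\<in>ball p d. \<forall>s\<in>{0..1}. \<forall>y z. (p', y) \<in> P \<times> UNIV \<longrightarrow>
      (p', z) \<in> P \<times> UNIV \<longrightarrow> norm (F s (p', y) - F s (p', z)) \<le> K * norm (y - z)" if "p \<in> P" for p
    using lip[OF that] by blast
  have "parametric_ode F P (P \<times> UNIV) (\<lambda>s p. w p s)"
    by unfold_locales (use \<open>open P\<close> open_D F_cont lip' w in blast)+
  with F show thesis using that by blast
qed

text \<open>
  Induction on \<open>k\<close> for all equations over \<open>P\<close> simultaneously. In the induction step the solution is already
  known to be \<open>C\<^sup>k\<close>; hence the variational equation for a directional derivative, whose
  coefficients are derivatives of \<open>F\<close> along \<open>(p, Y s p)\<close>, is itself a parametric problem with a \<open>C\<^sup>k\<close>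
  right-hand side, over the same parameters and with values in the same space. So the
  induction hypothesis applies to it as well. Differentiating in one fixed direction at a
  time is what keeps the type of the state space unchanged.
\<close>

theorem Ck_fam_solution:
  assumes "parametric_ode F P D Y" "Ck_fam k F D"
  shows "Ck_fam k Y P"
  using assms
proof (induction k arbitrary: F D Y)
  case 0
  then show ?case by (simp add: parametric_ode.solution_continuous)
next
  case (Suc k)
  interpret parametric_ode F P D Y by fact
  have Y: "Ck_fam k Y P"
    using Suc.IH[OF Suc.prems(1) Ck_fam_SucD[OF Suc.prems(2)]] .
  define F' where "F' s p = frechet_derivative (F s) (at (p, Y s p))" for s p
  have F'_linear: "linear (F' s p)" if "s \<in> {0..1}" "p \<in> P" for s p
    using Ck_fam_has_derivative[OF Suc.prems(2) that(1) in_D[OF that]] has_derivative_linear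
    unfolding F'_def by blast
  have "Ck_fam k (\<lambda>s p. (p, Y s p)) P"
    using Ck_fam_linear[OF bounded_linear_ident open_P] Y open_P by (rule Ck_fam_Pair)
  then have F': "Ck_fam k (\<lambda>s p. F' s p h) P" for h
    unfolding F'_def using Ck_fam_compose[OF Ck_fam_frechet[OF Suc.prems(2)] _ open_P] in_D by blast
  have F'_linear2: "linear (\<lambda>y. F' s p (0, y))" if "s \<in> {0..1}" "p \<in> P" for s p
    using linear_compose[OF _ F'_linear[OF that], of "\<lambda>y. (0, y)"]
    by (simp add: o_def linear_iff)
  let ?lin = "\<lambda>h s q. F' s (fst q) (0, snd q) + F' s (fst q) (h, 0)"
  have "\<forall>h. \<exists>W. parametric_ode (?lin h) P (P \<times> UNIV) W \<and> Ck_fam k W P"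
  proof
    fix h
    obtain W where W: "parametric_ode (?lin h) P (P \<times> UNIV) W" "Ck_fam k (?lin h) (P \<times> UNIV)"
      by (rule linear_parametric_ode_exists[where A = "\<lambda>s p y. F' s p (0, y)"
            and b = "\<lambda>s p. F' s p (h, 0)", OF open_P F' F'_linear2 F'])
    with Suc.IH[OF W] show "\<exists>W. parametric_ode (?lin h) P (P \<times> UNIV) W \<and> Ck_fam k W P"
      by blast
  qed
  from choice[OF this] obtain W
    where W: "parametric_ode (?lin h) P (P \<times> UNIV) (W h)" "Ck_fam k (W h) P" for h
    by blast
  show ?case
  proof (rule Ck_fam_SucI[OF open_P solution_continuous _ W(2)])
    fix s p assume s: "s \<in> {0..1::real}" and p: "p \<in> P"
    have "Ck_fam (Suc 0) F D"
      using Suc.prems(2) by (rule Ck_fam_mono) simp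
    then show "(Y s has_derivative (\<lambda>h. W h s p)) (at p)"
      using p s
    proof (rule has_derivative_solution)
      fix h show "W h 0 p = 0" using parametric_ode.init[OF W(1) p] .
      fix s assume s: "s \<in> {0..1::real}"
      have "F' s p (0, W h s p) + F' s p (h, 0) = F' s p (h, W h s p)"
        by (simp flip: linear_add[OF F'_linear[OF s p]])
      then show "((\<lambda>s. W h s p) has_vector_derivative
          frechet_derivative (F s) (at (p, Y s p)) (h, W h s p)) (at s within {0..1})"
        using parametric_ode.ode[OF W(1) s p, of h] by (simp add: F'_def)
    qed
  qed
qed

section \<open>Maximal solutions\<close>

locale lipschitz_ode =
  fixes I :: "real set" and M :: "'a::euclidean_space set"
    and v :: "real \<times> 'a \<Rightarrow> 'a" and L :: "real \<Rightarrow> real"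
  assumes open_I: "open I" and interval_I: "is_interval I" and open_M: "open M"
    and v_continuous: "continuous_on (I \<times> M) v"
    and L_continuous: "continuous_on I L" and L_nonneg: "\<And>t. t \<in> I \<Longrightarrow> L t \<ge> 0"
    and lipschitz: "\<And>t x y. t \<in> I \<Longrightarrow> x \<in> M \<Longrightarrow> y \<in> M \<Longrightarrow>
      norm (v (t, x) - v (t, y)) \<le> L t * norm (x - y)"
begin

lemma segment_in_interval:
  assumes "is_interval J" "\<tau> \<in> J" "\<sigma> \<in> J" "s \<in> {0..1::real}"
  shows "\<tau> + s * (\<sigma> - \<tau>) \<in> J"
proof -
  have "(1 - s) *\<^sub>R \<tau> + s *\<^sub>R \<sigma> \<in> J"
    using assms by (intro convexD_alt) (auto simp: is_interval_convex)
  then show ?thesis by (simp add: algebra_simps)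
qed

lemma reparametrised_solution:
  assumes x: "cauchy_solution I M v \<tau> \<xi> J x" and \<sigma>: "\<sigma> \<in> J" and s: "s \<in> {0..1}"
  shows "((\<lambda>s. x (\<tau> + s * (\<sigma> - \<tau>))) has_vector_derivative
    (\<sigma> - \<tau>) *\<^sub>R v (\<tau> + s * (\<sigma> - \<tau>), x (\<tau> + s * (\<sigma> - \<tau>)))) (at s within {0..1})"
proof -
  have "\<tau> + s * (\<sigma> - \<tau>) \<in> J"
    using x \<sigma> s by (intro segment_in_interval) (auto simp: cauchy_solution_def)
  then have x': "(x has_vector_derivative v (\<tau> + s * (\<sigma> - \<tau>), x (\<tau> + s * (\<sigma> - \<tau>)))) (at (\<tau> + s * (\<sigma> - \<tau>)))"
    using x by (simp add: cauchy_solution_def)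
  have "((\<lambda>s. \<tau> + s * (\<sigma> - \<tau>)) has_vector_derivative (\<sigma> - \<tau>)) (at s)"
    by (auto intro!: derivative_eq_intros)
  from vector_diff_chain_at[OF this x'] show ?thesis
    unfolding o_def by (rule has_vector_derivative_at_within)
qed

lemma cauchy_solution_unique:
  assumes x: "cauchy_solution I M v \<tau> \<xi> J x" and y: "cauchy_solution I M v \<tau> \<xi> J' y"
    and \<sigma>: "\<sigma> \<in> J" "\<sigma> \<in> J'"
  shows "x \<sigma> = y \<sigma>"
proof -
  define t where "t s = \<tau> + s * (\<sigma> - \<tau>)" for s
  have t: "t s \<in> J" "t s \<in> J'" "t s \<in> I" if "s \<in> {0..1}" for s
    using x y \<sigma> that segment_in_interval unfolding t_def by (auto simp: cauchy_solution_def)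
  have "continuous_on {0..1} (\<lambda>s. (\<sigma> - \<tau>) * L (t s))"
    using t(3) by (intro continuous_intros continuous_on_compose2[OF L_continuous])
      (auto simp: t_def intro!: continuous_intros)
  from continuous_on_compact_norm_bound[OF compact_Icc this] obtain K
    where K: "\<And>s. s \<in> {0..1} \<Longrightarrow> \<bar>(\<sigma> - \<tau>) * L (t s)\<bar> \<le> K"
    by (metis real_norm_def)
  have "norm (x (t 1) - y (t 1)) \<le> 0 * exp (K + 1)"
  proof (rule gronwall_zero[where u = "\<lambda>s. x (t s) - y (t s)" and u' = "\<lambda>s. (\<sigma> - \<tau>) *\<^sub>R v (t s, x (t s)) - (\<sigma> - \<tau>) *\<^sub>R v (t s, y (t s))"])
    show "K \<ge> 0" using K[of 0] by force
    fix s assume s: "s \<in> {0..1::real}"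
    show "((\<lambda>s. x (t s) - y (t s)) has_vector_derivative
        (\<sigma> - \<tau>) *\<^sub>R v (t s, x (t s)) - (\<sigma> - \<tau>) *\<^sub>R v (t s, y (t s))) (at s within {0..1})"
      unfolding t_def using \<sigma> s
      by (intro has_vector_derivative_diff reparametrised_solution[OF x] reparametrised_solution[OF y])
    have "x (t s) \<in> M" "y (t s) \<in> M"
      using x y t[OF s] by (auto simp: cauchy_solution_def)
    then have "norm (v (t s, x (t s)) - v (t s, y (t s))) \<le> L (t s) * norm (x (t s) - y (t s))"
      using lipschitz t[OF s] by blast
    then have "\<bar>\<sigma> - \<tau>\<bar> * norm (v (t s, x (t s)) - v (t s, y (t s)))
        \<le> \<bar>\<sigma> - \<tau>\<bar> * (L (t s) * norm (x (t s) - y (t s)))"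
      by (rule mult_left_mono) simp
    also have "\<dots> = \<bar>(\<sigma> - \<tau>) * L (t s)\<bar> * norm (x (t s) - y (t s))"
      using L_nonneg[OF t(3)[OF s]] by (simp add: abs_mult)
    also have "\<dots> \<le> K * norm (x (t s) - y (t s))"
      using K[OF s] by (rule mult_right_mono) simp
    finally show "norm ((\<sigma> - \<tau>) *\<^sub>R v (t s, x (t s)) - (\<sigma> - \<tau>) *\<^sub>R v (t s, y (t s)))
        \<le> K * norm (x (t s) - y (t s)) + 0"
      by (simp flip: scaleR_diff_right)
  qed (use x y in \<open>auto simp: cauchy_solution_def t_def\<close>)
  then show ?thesis by (simp add: t_def)
qed

text \<open>
  Composing \<open>v\<close> with the nearest-point projection onto a ball around \<open>x0\<close> makes the equation globally
  Lipschitz in the space variable. For a short time the solution of the modified equation cannot leave the ball, where both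
  equations agree.
\<close>

lemma cauchy_solution_exists_locally:
  assumes t0: "t0 \<in> I" and x0: "x0 \<in> M"
  obtains J x where "cauchy_solution I M v t0 x0 J x"
proof -
  obtain \<rho> where \<rho>: "\<rho> > 0" "cball x0 \<rho> \<subseteq> M"
    using open_M x0 open_contains_cball by blast
  obtain e where e: "e > 0" "cball t0 e \<subseteq> I"
    using open_I t0 open_contains_cball by blast
  have "continuous_on (cball t0 e \<times> cball x0 \<rho>) v"
    using \<rho>(2) e(2) by (intro continuous_on_subset[OF v_continuous]) auto
  then obtain B where B: "\<And>q. q \<in> cball t0 e \<times> cball x0 \<rho> \<Longrightarrow> norm (v q) \<le> B"
    using continuous_on_compact_norm_bound[OF compact_Times[OF compact_cball compact_cball]] by blast
  obtain K where K: "\<And>t. t \<in> cball t0 e \<Longrightarrow> norm (L t) \<le> K"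
    using continuous_on_compact_norm_bound[OF compact_cball continuous_on_subset[OF L_continuous e(2)]]
    by blast
  have "norm (v (t0, x0)) \<le> B" "norm (L t0) \<le> K"
    by (rule B K; use \<rho>(1) e(1) in simp)+
  then have "B \<ge> 0" "K \<ge> 0"
    using norm_ge_zero order_trans by blast+
  define \<delta> where "\<delta> = min e (\<rho> / (B + 1))"
  have \<delta>: "\<delta> > 0" "\<delta> \<le> e" "\<delta> \<le> \<rho> / (B + 1)"
    using \<rho>(1) e(1) \<open>B \<ge> 0\<close> by (auto simp: \<delta>_def)
  have Icc: "{t0 - \<delta>..t0 + \<delta>} \<subseteq> cball t0 e"
    using \<delta> by (auto simp: dist_real_def)
  define c where "c = closest_point (cball x0 \<rho>)"
  have c: "c y \<in> cball x0 \<rho>" for y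
    unfolding c_def using \<rho>(1) by (intro closest_point_in_set) auto
  have c_continuous: "continuous_on T c" for T
    unfolding c_def using \<rho>(1) by (intro continuous_on_closest_point) auto
  have c_lipschitz: "norm (c y - c z) \<le> norm (y - z)" for y z
    using closest_point_lipschitz[of "cball x0 \<rho>" y z] \<rho>(1) by (simp add: c_def dist_norm)
  have cont: "continuous_on ({t0 - \<delta>..t0 + \<delta>} \<times> UNIV) (\<lambda>q. v (fst q, c (snd q)))" 
  proof (rule continuous_on_compose2[OF v_continuous])
    show "continuous_on ({t0 - \<delta>..t0 + \<delta>} \<times> UNIV) (\<lambda>q. (fst q, c (snd q)))"
      by (intro continuous_intros continuous_on_compose2[OF c_continuous[of UNIV]]) auto
    show "(\<lambda>q. (fst q, c (snd q))) ` ({t0 - \<delta>..t0 + \<delta>} \<times> UNIV) \<subseteq> I \<times> M"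
      using Icc e(2) c \<rho>(2) by auto
  qed
  have lip: "norm (v (t, c y) - v (t, c z)) \<le> K * norm (y - z)"
    if "t \<in> {t0 - \<delta>..t0 + \<delta>}" for t y z
  proof -
    have t: "t \<in> I" "t \<in> cball t0 e" using that Icc e(2) by auto
    have "norm (v (t, c y) - v (t, c z)) \<le> L t * norm (c y - c z)"
      using lipschitz[OF t(1)] c \<rho>(2) by blast
    also have "\<dots> \<le> K * norm (y - z)"
      using K[OF t(2)] L_nonneg[OF t(1)] c_lipschitz by (intro mult_mono) auto
    finally show ?thesis .
  qed
  have "t0 \<in> {t0 - \<delta>..t0 + \<delta>}" using \<delta>(1) by simp
  from picard_lindelof_global[of t0 "t0 - \<delta>" "t0 + \<delta>" K "\<lambda>t y. v (t, c y)" x0,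
      OF this \<open>K \<ge> 0\<close> cont lip]
  obtain y where y: "y t0 = x0" "\<And>t. t \<in> {t0 - \<delta>..t0 + \<delta>} \<Longrightarrow>
      (y has_vector_derivative v (t, c (y t))) (at t within {t0 - \<delta>..t0 + \<delta>})"
    by blast
  have y_near: "y t \<in> cball x0 \<rho>" if t: "t \<in> {t0 - \<delta>..t0 + \<delta>}" for t
  proof -
    have "norm (y t - x0) \<le> B * \<bar>t - t0\<bar> ^ Suc 0 / Suc 0"
    proof (rule norm_bound_of_derivative_power_bound[OF _ t, where d' = "\<lambda>t. v (t, c (y t))"])
      fix x assume x: "x \<in> {t0 - \<delta>..t0 + \<delta>}"
      show "((\<lambda>t. y t - x0) has_vector_derivative v (x, c (y x))) (at x within {t0 - \<delta>..t0 + \<delta>})"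
        using has_vector_derivative_diff[OF y(2)[OF x] has_vector_derivative_const[of x0]] by simp
      show "norm (v (x, c (y x))) \<le> B * \<bar>x - t0\<bar> ^ 0"
        using B[of "(x, c (y x))"] x Icc c by auto
    qed (use \<delta> y(1) in auto)
    also have "\<dots> \<le> (B + 1) * \<delta>"
      using t \<open>B \<ge> 0\<close> by (simp, intro mult_mono) auto
    also have "\<dots> \<le> \<rho>"
      using \<delta>(3) \<open>B \<ge> 0\<close> by (simp add: pos_le_divide_eq mult.commute)
    finally show ?thesis by (simp add: dist_norm norm_minus_commute)
  qed
  have "cauchy_solution I M v t0 x0 {t0 - \<delta><..<t0 + \<delta>} y"
    unfolding cauchy_solution_def
  proof (intro conjI ballI)
    fix t assume "t \<in> {t0 - \<delta><..<t0 + \<delta>}"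
    then have t: "t \<in> {t0 - \<delta>..t0 + \<delta>}" "t0 - \<delta> < t" "t < t0 + \<delta>" by auto
    show "y t \<in> M" using y_near[OF t(1)] \<rho>(2) by blast
    have "c (y t) = y t" unfolding c_def using y_near[OF t(1)] by (rule closest_point_self)
    then show "(y has_vector_derivative v (t, y t)) (at t)"
      using y(2)[OF t(1)] at_within_Icc_at[OF t(2,3)] by simp
  next
    show "{t0 - \<delta><..<t0 + \<delta>} \<subseteq> I"
      using subset_trans[OF Icc e(2)] by (auto simp: subset_eq)
  qed (use \<delta> y(1) in \<open>auto simp: is_interval_def\<close>)
  then show thesis by (rule that)
qed

text \<open>
  By uniqueness all solutions with the given initial value fit together to one on the union of
  their domains.
\<close>

lemma maximal_cauchy_solution_exists:
  assumes "t0 \<in> I" "x0 \<in> M"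
  obtains J x where "maximal_cauchy_solution I M v t0 x0 J x"
proof -
  let ?S = "cauchy_solution I M v t0 x0"
  define U where "U = \<Union>{J. \<exists>x. ?S J x}"
  define z where "z t = (SOME c. \<exists>J x. ?S J x \<and> t \<in> J \<and> c = x t)" for t
  have z: "z t = x t" if "?S J x" "t \<in> J" for J x t
  proof -
    have "\<exists>c J x. ?S J x \<and> t \<in> J \<and> c = x t" using that by blast
    from someI_ex[OF this] obtain J' y where "?S J' y" "t \<in> J'" "z t = y t"
      unfolding z_def by blast
    with that show ?thesis using cauchy_solution_unique by metis
  qed
  obtain J0 y0 where y0: "?S J0 y0"
    using cauchy_solution_exists_locally[OF assms] .
  have "?S U z"
    unfolding cauchy_solution_def
  proof (intro conjI ballI)
    show "open U" "U \<subseteq> I" by (auto simp: U_def cauchy_solution_def)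
    have "connected U"
      unfolding U_def
      by (rule connected_Union) (auto simp: cauchy_solution_def is_interval_connected_1)
    then show "is_interval U" by (simp add: is_interval_connected_1)
    show "t0 \<in> U" using y0 by (auto simp: U_def cauchy_solution_def)
    show "z t0 = x0" using z[OF y0] y0 by (simp add: cauchy_solution_def)
    fix t assume "t \<in> U"
    then obtain J x where x: "?S J x" "t \<in> J" by (auto simp: U_def)
    have eq: "z t = x t" using z[OF x] .
    show "z t \<in> M" using x eq by (simp add: cauchy_solution_def)
    have "(x has_vector_derivative v (t, x t)) (at t)" "open J"
      using x by (auto simp: cauchy_solution_def)
    then have "(z has_vector_derivative v (t, x t)) (at t)"
      using x(2) by (rule has_vector_derivative_transform_within_open) (simp add: z[OF x(1)])
    then show "(z has_vector_derivative v (t, z t)) (at t)" by (simp add: eq)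
  qed
  then have "maximal_cauchy_solution I M v t0 x0 U z"
    by (auto simp: maximal_cauchy_solution_def U_def)
  then show thesis by (rule that)
qed

end

section \<open>The flow of a complete equation\<close>

locale complete_ode = lipschitz_ode +
  assumes complete: "\<And>t0 x0 J x. t0 \<in> I \<Longrightarrow> x0 \<in> M \<Longrightarrow> maximal_cauchy_solution I M v t0 x0 J x \<Longrightarrow> J = I"
begin

definition flow :: "real \<Rightarrow> real \<Rightarrow> 'a \<Rightarrow> 'a" where
  "flow \<sigma> \<tau> \<xi> = (SOME x. cauchy_solution I M v \<tau> \<xi> I x) \<sigma>"

lemma flow_solution:
  assumes "\<tau> \<in> I" "\<xi> \<in> M"
  shows "cauchy_solution I M v \<tau> \<xi> I (\<lambda>\<sigma>. flow \<sigma> \<tau> \<xi>)"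
proof -
  obtain J x where x: "maximal_cauchy_solution I M v \<tau> \<xi> J x"
    using maximal_cauchy_solution_exists[OF assms] .
  then have "cauchy_solution I M v \<tau> \<xi> I x"
    using complete[OF assms x] by (simp add: maximal_cauchy_solution_def)
  from someI[of "cauchy_solution I M v \<tau> \<xi> I", OF this] show ?thesis
    by (simp add: flow_def)
qed

lemma flow_in_M: "\<sigma> \<in> I \<Longrightarrow> \<tau> \<in> I \<Longrightarrow> \<xi> \<in> M \<Longrightarrow> flow \<sigma> \<tau> \<xi> \<in> M"
  and flow_initial: "\<tau> \<in> I \<Longrightarrow> \<xi> \<in> M \<Longrightarrow> flow \<tau> \<tau> \<xi> = \<xi>"
  and flow_ode: "\<sigma> \<in> I \<Longrightarrow> \<tau> \<in> I \<Longrightarrow> \<xi> \<in> M \<Longrightarrow>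
    ((\<lambda>\<sigma>. flow \<sigma> \<tau> \<xi>) has_vector_derivative v (\<sigma>, flow \<sigma> \<tau> \<xi>)) (at \<sigma>)"
  using flow_solution by (auto simp: cauchy_solution_def)

lemma flow_flow:
  assumes "\<rho> \<in> I" "\<sigma> \<in> I" "\<tau> \<in> I" "\<xi> \<in> M"
  shows "flow \<rho> \<sigma> (flow \<sigma> \<tau> \<xi>) = flow \<rho> \<tau> \<xi>"
proof (rule cauchy_solution_unique[where x = "\<lambda>\<rho>. flow \<rho> \<sigma> (flow \<sigma> \<tau> \<xi>)" and y = "\<lambda>\<rho>. flow \<rho> \<tau> \<xi>"])
  show "cauchy_solution I M v \<sigma> (flow \<sigma> \<tau> \<xi>) I (\<lambda>\<rho>. flow \<rho> \<sigma> (flow \<sigma> \<tau> \<xi>))"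
    using assms by (intro flow_solution flow_in_M)
  show "cauchy_solution I M v \<sigma> (flow \<sigma> \<tau> \<xi>) I (\<lambda>\<rho>. flow \<rho> \<tau> \<xi>)"
    using flow_solution[OF assms(3,4)] assms(2) by (simp add: cauchy_solution_def)
qed (use assms in auto)

text \<open>
  The solution from time \<open>\<tau>\<close> to time \<open>\<sigma>\<close> is run through at speed \<open>\<sigma> - \<tau>\<close> over \<open>[0,1]\<close>, and its
  initial value \<open>\<xi>\<close> is subtracted. Then \<open>\<sigma>\<close>, \<open>\<tau>\<close> and \<open>\<xi>\<close> become parameters of one problem with zero initial value,
  and evaluating its solution at \<open>s = 1\<close> gives smoothness of the flow in all its
  arguments at once, the initial time included.
\<close>

lemma Ck_on_flow:
  assumes v: "Ck_on k v (I \<times> M)"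
  shows "Ck_on k (\<lambda>p. flow (fst p) (fst (snd p)) (snd (snd p))) (I \<times> I \<times> M)"
proof -
  define P where "P = I \<times> I \<times> M"
  define T where "T s p = fst (snd p) + s * (fst p - fst (snd p))" for s and p :: "real \<times> real \<times> 'a"
  define D where "D = {q :: (real \<times> real \<times> 'a) \<times> 'a. fst (fst q) \<in> I \<and> fst (snd (fst q)) \<in> I
    \<and> snd (snd (fst q)) + snd q \<in> M}"
  define F where "F s q = (fst (fst q) - fst (snd (fst q))) *\<^sub>R v (T s (fst q), snd (snd (fst q)) + snd q)"
    for s and q :: "(real \<times> real \<times> 'a) \<times> 'a"
  define Y where "Y s p = flow (T s p) (fst (snd p)) (snd (snd p)) - snd (snd p)" for s p
  have open_P: "open P"
    unfolding P_def by (intro open_Times open_I open_M)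
  have "D = (\<lambda>q. fst (fst q)) -` I \<inter> (\<lambda>q. fst (snd (fst q))) -` I \<inter> (\<lambda>q. snd (snd (fst q)) + snd q) -` M"
    by (auto simp: D_def)
  then have open_D: "open D"
    by (auto intro!: open_Int open_vimage open_I open_M continuous_intros)
  have T_I: "T s p \<in> I" if "s \<in> {0..1}" "fst p \<in> I" "fst (snd p) \<in> I" for s p
    unfolding T_def using that interval_I by (intro segment_in_interval)
  have \<sigma>: "Ck_fam k (\<lambda>s q. fst (fst q)) D" and \<tau>: "Ck_fam k (\<lambda>s q. fst (snd (fst q))) D"
    and \<xi>: "Ck_fam k (\<lambda>s q. snd (snd (fst q))) D" and y: "Ck_fam k (\<lambda>s q. snd q) D"
    by (intro Ck_fam_linear open_D bounded_linear_intros)+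
  have \<sigma>\<tau>: "Ck_fam k (\<lambda>s q. fst (fst q) - fst (snd (fst q))) D"
    by (intro Ck_fam_linear open_D bounded_linear_intros)
  have "Ck_fam k (\<lambda>s q. fst (snd (fst q)) + s *\<^sub>R (fst (fst q) - fst (snd (fst q)))) D"
    by (intro Ck_fam_add Ck_fam_scaleR \<sigma>\<tau> \<tau> open_D Ck_fam_const continuous_intros)
  then have "Ck_fam k (\<lambda>s q. T s (fst q)) D"
    by (simp add: T_def)
  then have "Ck_fam k (\<lambda>s q. (T s (fst q), snd (snd (fst q)) + snd q)) D"
    by (intro Ck_fam_Pair Ck_fam_add \<xi> y open_D)
  then have "Ck_fam k (\<lambda>s q. v (T s (fst q), snd (snd (fst q)) + snd q)) D"
    using open_D T_I
    by (intro Ck_fam_compose[OF Ck_fam_of_Ck_on[OF v open_Times[OF open_I open_M]]]) (auto simp: D_def)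
  then have F: "Ck_fam k F D"
    unfolding F_def by (intro Ck_fam_scaleR \<sigma>\<tau> open_D)
  have "parametric_ode F P D Y"
  proof
    show "continuous_on ({0..1} \<times> D) (\<lambda>q. F (fst q) (snd q))"
      using F by (rule Ck_fam_continuous)
  next
    fix p assume "p \<in> P"
    then have "p \<in> I \<times> I \<times> (UNIV :: 'a set)" by (auto simp: P_def)
    moreover have "open (I \<times> I \<times> (UNIV :: 'a set))" by (intro open_Times open_I open_UNIV)
    ultimately obtain d where d: "d > 0" "cball p d \<subseteq> I \<times> I \<times> UNIV"
      using open_contains_cball by blast
    have dI: "fst p' \<in> I" "fst (snd p') \<in> I" if "p' \<in> cball p d" for p'
      using d(2) that by (auto dest!: subsetD)
    have "continuous_on ({0..1} \<times> cball p d) (\<lambda>q. (fst (snd q) - fst (snd (snd q))) * L (T (fst q) (snd q)))"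
      using dI T_I by (intro continuous_intros continuous_on_compose2[OF L_continuous])
        (auto simp: T_def intro!: continuous_intros)
    then obtain K where K: "\<And>q. q \<in> {0..1} \<times> cball p d \<Longrightarrow>
        norm ((fst (snd q) - fst (snd (snd q))) * L (T (fst q) (snd q))) \<le> K"
      using continuous_on_compact_norm_bound[OF compact_Times[OF compact_Icc compact_cball]] by blast
    have "norm ((fst p - fst (snd p)) * L (T 0 p)) \<le> K"
      using K[of "(0, p)"] d(1) by simp
    then have "K \<ge> 0" using norm_ge_zero order_trans by blast
    moreover have "norm (F s (p', y) - F s (p', z)) \<le> K * norm (y - z)"
      if p': "p' \<in> ball p d" and s: "s \<in> {0..1}" and "(p', y) \<in> D" "(p', z) \<in> D" for p' s y z
    proof -
      have I: "T s p' \<in> I" using dI[of p'] p' s by (intro T_I) auto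
      have "norm (F s (p', y) - F s (p', z)) = \<bar>fst p' - fst (snd p')\<bar> *
          norm (v (T s p', snd (snd p') + y) - v (T s p', snd (snd p') + z))"
        by (simp add: F_def flip: scaleR_diff_right)
      also have "\<dots> \<le> \<bar>fst p' - fst (snd p')\<bar> * (L (T s p') * norm ((snd (snd p') + y) - (snd (snd p') + z)))"
        using that(3,4) by (intro mult_left_mono lipschitz I) (auto simp: D_def)
      also have "\<dots> = norm ((fst p' - fst (snd p')) * L (T s p')) * norm (y - z)"
        using L_nonneg[OF I] by (simp add: abs_mult)
      also have "\<dots> \<le> K * norm (y - z)"
        using K[of "(s, p')"] p' s by (intro mult_right_mono) auto
      finally show ?thesis .
    qed
    ultimately show "\<exists>K\<ge>0. \<exists>d>0. \<forall>p'\<in>ball p d. \<forall>s\<in>{0..1}. \<forall>y z. (p', y) \<in> D \<longrightarrow> (p', z) \<in> D \<longrightarrow>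
        norm (F s (p', y) - F s (p', z)) \<le> K * norm (y - z)"
      using d(1) by blast
  next
    fix s p assume s: "s \<in> {0..1::real}" and p: "p \<in> P"
    show "(p, Y s p) \<in> D"
      using p s T_I flow_in_M by (auto simp: D_def Y_def P_def)
    have "((\<lambda>s. Y s p) has_vector_derivative (fst p - fst (snd p)) *\<^sub>R
        v (T s p, flow (T s p) (fst (snd p)) (snd (snd p)))) (at s within {0..1})"
      unfolding Y_def T_def has_vector_derivative_diff_const
      by (rule reparametrised_solution[OF flow_solution]) (use p s in \<open>auto simp: P_def\<close>)
    then show "((\<lambda>s. Y s p) has_vector_derivative F s (p, Y s p)) (at s within {0..1})"
      by (simp add: F_def Y_def)
  next
    fix p assume "p \<in> P"
    then show "Y 0 p = 0" by (auto simp: Y_def T_def P_def flow_initial)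
  qed (fact open_P open_D)+
  then have "Ck_fam k Y P" using F by (rule Ck_fam_solution)
  then have "Ck_fam k (\<lambda>s p. Y s p + snd (snd p)) P"
    by (intro Ck_fam_add open_P Ck_fam_linear bounded_linear_intros)
  from Ck_on_of_Ck_fam[OF this, of 1] show ?thesis
    by (simp add: Y_def T_def P_def)
qed

end

section \<open>Rectification\<close>

lemma bij_betw_inverse_on:
  assumes "f ` A \<subseteq> B" "g ` B \<subseteq> A" "\<And>x. x \<in> A \<Longrightarrow> g (f x) = x" "\<And>y. y \<in> B \<Longrightarrow> f (g y) = y"
  shows "bij_betw f A B" "\<And>y. y \<in> B \<Longrightarrow> inv_into A f y = g y"
proof -
  show bij: "bij_betw f A B"
    using assms by (intro bij_betw_byWitness[where f' = g]) auto
  show "inv_into A f y = g y" if "y \<in> B" for y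
    using that assms by (intro inv_into_f_eq bij_betw_imp_inj_on[OF bij]) auto
qed

lemma Ck_diffeo_of_inverse:
  assumes "open D" "open E" "Ck_on k F D" "Ck_on k G E" "F ` D \<subseteq> E" "G ` E \<subseteq> D"
    and "\<And>x. x \<in> D \<Longrightarrow> G (F x) = x" "\<And>y. y \<in> E \<Longrightarrow> F (G y) = y"
  shows "Ck_diffeo k D E F"
proof -
  note inverse = bij_betw_inverse_on[of F D E G, OF assms(5-8)]
  have "Ck_on k (inv_into D F) E"
    using assms(4,2) by (rule Ck_on_cong) (simp add: inverse(2))
  with inverse(1) assms(1-3) show ?thesis by (simp add: Ck_diffeo_def)
qed

context complete_ode
begin

text \<open>
  Sliding every point along its trajectory to the instant \<open>t0\<close> while keeping its time, and the inverse map.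
  Both are made of the flow, so the smoothness of the flow covers the inverse too, without an inverse
  function theorem.
\<close>

definition straighten :: "real \<Rightarrow> real \<times> 'a \<Rightarrow> real \<times> 'a" where
  "straighten t0 q = (fst q, flow t0 (fst q) (snd q))"

definition unstraighten :: "real \<Rightarrow> real \<times> 'a \<Rightarrow> real \<times> 'a" where
  "unstraighten t0 q = (fst q, flow (fst q) t0 (snd q))"

lemma straighten_maps_to:
  assumes "t0 \<in> I"
  shows "straighten t0 ` (I \<times> M) \<subseteq> I \<times> M" "unstraighten t0 ` (I \<times> M) \<subseteq> I \<times> M"
  using assms flow_in_M by (auto simp: straighten_def unstraighten_def)

lemma straighten_inverse:
  assumes "t0 \<in> I" "q \<in> I \<times> M"
  shows "unstraighten t0 (straighten t0 q) = q" "straighten t0 (unstraighten t0 q) = q"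
  using assms by (auto simp: straighten_def unstraighten_def flow_flow flow_initial)

lemma Ck_on_flow_from_to:
  assumes v: "Ck_on k v (I \<times> M)" and t0: "t0 \<in> I"
  shows "Ck_on k (\<lambda>q. flow t0 (fst q) (snd q)) (I \<times> M)"
    and "Ck_on k (\<lambda>q. flow (fst q) t0 (snd q)) (I \<times> M)"
proof -
  have op: "open (I \<times> M)" "open (I \<times> I \<times> M)"
    by (intro open_Times open_I open_M)+
  note flow = Ck_fam_of_Ck_on[OF Ck_on_flow[OF v] op(2)]
  have proj: "Ck_fam k (\<lambda>s. fst) (I \<times> M)" "Ck_fam k (\<lambda>s. snd) (I \<times> M)" "Ck_fam k (\<lambda>s q. t0) (I \<times> M)"
    by (intro Ck_fam_linear Ck_fam_const op bounded_linear_fst bounded_linear_snd continuous_intros)+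
  have "Ck_fam k (\<lambda>s q. (t0, (fst q, snd q))) (I \<times> M)" "Ck_fam k (\<lambda>s q. (fst q, (t0, snd q))) (I \<times> M)"
    by (intro Ck_fam_Pair proj op)+
  then have "Ck_fam k (\<lambda>s q. flow t0 (fst q) (snd q)) (I \<times> M)"
    and "Ck_fam k (\<lambda>s q. flow (fst q) t0 (snd q)) (I \<times> M)"
    using Ck_fam_compose[OF flow _ op(1)] t0 by force+
  then show "Ck_on k (\<lambda>q. flow t0 (fst q) (snd q)) (I \<times> M)"
    and "Ck_on k (\<lambda>q. flow (fst q) t0 (snd q)) (I \<times> M)"
    using Ck_on_of_Ck_fam[of k _ _ 0] by force+
qed

lemma Ck_on_Pair_fst:
  assumes "Ck_on k g (I \<times> M)"
  shows "Ck_on k (\<lambda>q. (fst q, g q)) (I \<times> M)"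
proof -
  have op: "open (I \<times> M)"
    by (intro open_Times open_I open_M)
  have "Ck_fam k (\<lambda>s q. (fst q, g q)) (I \<times> M)"
    by (intro Ck_fam_Pair Ck_fam_linear bounded_linear_fst Ck_fam_of_Ck_on assms op)
  from Ck_on_of_Ck_fam[OF this, of 0] show ?thesis by simp
qed

lemma Ck_on_straighten:
  assumes "Ck_on k v (I \<times> M)" "t0 \<in> I"
  shows "Ck_on k (straighten t0) (I \<times> M)" "Ck_on k (unstraighten t0) (I \<times> M)"
  unfolding straighten_def[abs_def] unstraighten_def[abs_def]
  by (intro Ck_on_Pair_fst Ck_on_flow_from_to assms)+

lemma Ck_diffeo_straighten:
  assumes "Ck_on k v (I \<times> M)" "t0 \<in> I"
  shows "Ck_diffeo k (I \<times> M) (I \<times> M) (straighten t0)"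
    and "Ck_diffeo k (I \<times> M) (I \<times> M) (unstraighten t0)"
  using Ck_on_straighten[OF assms] straighten_maps_to[OF assms(2)] straighten_inverse[OF assms(2)]
    open_Times[OF open_I open_M]
  by (blast intro: Ck_diffeo_of_inverse)+

text \<open>
  Along the graph of a solution the position at the instant \<open>t0\<close> is constant, so \<open>straighten t0\<close> maps
  the curve \<open>u \<mapsto> (u, flow u t x)\<close>, which has velocity \<open>(1, v (t, x))\<close> at \<open>t\<close>, to a curve with
  velocity \<open>(1, 0)\<close>.
\<close>

lemma straighten_has_derivative:
  assumes v: "Ck_on (Suc j) v (I \<times> M)" and "t0 \<in> I" "t \<in> I" "x \<in> M"
  obtains S where "(straighten t0 has_derivative S) (at (t, x))" and "S (1, v (t, x)) = (1, 0)"
proof -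
  have "straighten t0 differentiable at (t, x)"
    using Ck_on_straighten(1)[OF v \<open>t0 \<in> I\<close>] assms by simp
  then obtain S where S: "(straighten t0 has_derivative S) (at (t, x))"
    by (auto simp: differentiable_def)
  have "((\<lambda>u. (u, flow u t x)) has_derivative (\<lambda>h. (h, h *\<^sub>R v (t, flow t t x)))) (at t)"
    using flow_ode[OF assms(3,3,4)]
    by (auto simp: has_vector_derivative_def intro!: derivative_eq_intros)
  then have "((\<lambda>u. straighten t0 (u, flow u t x)) has_derivative (\<lambda>h. S (h, h *\<^sub>R v (t, x)))) (at t)"
    using S has_derivative_compose[of "\<lambda>u. (u, flow u t x)" _ t UNIV "straighten t0" S]
    by (simp add: flow_initial assms)
  moreover have "((\<lambda>u. straighten t0 (u, flow u t x)) has_derivative (\<lambda>h. (h, 0))) (at t)"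
  proof (rule has_derivative_transform_within_open[OF _ open_I \<open>t \<in> I\<close>])
    show "((\<lambda>u. (u, flow t0 t x)) has_derivative (\<lambda>h. (h, 0))) (at t)"
      by (auto intro!: derivative_eq_intros)
    show "(u, flow t0 t x) = straighten t0 (u, flow u t x)" if "u \<in> I" for u
      using that assms by (simp add: straighten_def flow_flow)
  qed
  ultimately have "(\<lambda>h. S (h, h *\<^sub>R v (t, x))) = (\<lambda>h. (h, 0))"
    by (rule has_derivative_unique)
  from fun_cong[OF this, of 1] have "S (1, v (t, x)) = (1, 0)" by simp
  with S show thesis by (rule that)
qed

lemma rectification_straighten:
  assumes v: "Ck_on (Suc j) v (I \<times> M)" and t0: "t0 \<in> I"
  shows "rectification (Suc j) (I \<times> M) (I \<times> M) (direction_field v) (straighten t0)"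
  unfolding rectification_def
proof (intro conjI exI ballI)
  show "Ck_diffeo (Suc j) (I \<times> M) (I \<times> M) (straighten t0)"
    using Ck_diffeo_straighten(1)[OF assms] .
  show "parallel_directions (I \<times> M) (\<lambda>_. span {(1, 0) :: real \<times> 'a})"
    unfolding parallel_directions_def
    by (intro exI[of _ "span {(1, 0) :: real \<times> 'a}"]) (auto simp: dim_span zero_prod_def)
  fix q assume "q \<in> I \<times> M"
  then obtain t x where q: "q = (t, x)" "t \<in> I" "x \<in> M" by auto
  obtain S where S: "(straighten t0 has_derivative S) (at q)" "S (1, v q) = (1, 0)"
    using straighten_has_derivative[OF v t0 q(2,3)] q(1) by metis
  have "S ` span {(1, v q)} = span (S ` {(1, v q)})"
    using linear_span_image[OF has_derivative_linear[OF S(1)]] by metis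
  then show "frechet_derivative (straighten t0) (at q) ` direction_field v q = span {(1, 0)}"
    using S frechet_derivative_at[OF S(1)] by (simp add: direction_field_def)
qed

lemma time_preserving_straighten:
  assumes v: "Ck_on k v (I \<times> M)" and "k \<ge> 1" and t0: "t0 \<in> I"
  shows "time_preserving I M M (straighten t0)" "time_preserving I M M (unstraighten t0)"
proof -
  have "Ck_on 1 v (I \<times> M)"
    using Ck_on_of_Ck_fam[OF Ck_fam_mono[OF Ck_fam_of_Ck_on[OF v] \<open>k \<ge> 1\<close>], of 0] open_Times[OF open_I open_M]
    by simp
  note C1 = Ck_on_flow_from_to[OF this t0]
  show "time_preserving I M M (straighten t0)"
    unfolding time_preserving_def using C1(1) t0
    by (intro exI[of _ "\<lambda>q. flow t0 (fst q) (snd q)"])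
      (auto simp: straighten_def flow_in_M simp del: Ck_on.simps One_nat_def)
  show "time_preserving I M M (unstraighten t0)"
    unfolding time_preserving_def using C1(2) t0
    by (intro exI[of _ "\<lambda>q. flow (fst q) t0 (snd q)"])
      (auto simp: unstraighten_def flow_in_M simp del: Ck_on.simps One_nat_def)
qed

lemma inv_unstraighten_derivative:
  assumes v: "Ck_on (Suc j) v (I \<times> M)" and t0: "t0 \<in> I" and "t \<in> I" "x \<in> M"
  shows "frechet_derivative (inv_into (I \<times> M) (unstraighten t0)) (at (t, x)) (1, v (t, x)) = (1, 0)"
proof -
  obtain S where S: "(straighten t0 has_derivative S) (at (t, x))" "S (1, v (t, x)) = (1, 0)"
    using straighten_has_derivative[OF assms] .
  have "(inv_into (I \<times> M) (unstraighten t0) has_derivative S) (at (t, x))"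
  proof (rule has_derivative_transform_within_open[OF S(1) open_Times[OF open_I open_M]])
    fix q assume "q \<in> I \<times> M"
    then show "straighten t0 q = inv_into (I \<times> M) (unstraighten t0) q"
      using bij_betw_inverse_on(2)[OF straighten_maps_to(2,1)[OF t0] straighten_inverse(2,1)[OF t0]] by simp
  qed (use assms in simp)
  from frechet_derivative_at[OF this] S(2) show ?thesis by metis
qed

end

theorem theorem3p2:
  fixes I :: "real set"
    and M :: "(real ^ 'n) set"
    and v :: "real \<times> (real ^ 'n) \<Rightarrow> real ^ 'n"
    and L :: "real \<Rightarrow> real"
    and r :: nat
  assumes "open I" and "is_interval I" and "I \<noteq> {}"
    and "open M"
    and "r \<ge> 1"
    and "Ck_on r v (I \<times> M)"
    and "continuous_on I L"
    and "\<forall>t\<in>I. L t \<ge> 0"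
    and "\<forall>t\<in>I. \<forall>x1\<in>M. \<forall>x2\<in>M. norm (v (t, x1) - v (t, x2)) \<le> L t * norm (x1 - x2)"
    and "\<forall>t0\<in>I. \<forall>x0\<in>M. \<forall>J x. maximal_cauchy_solution I M v t0 x0 J x \<longrightarrow> J = I"
  shows "(\<exists>N F. time_preserving I M N F \<and>
            rectification r (I \<times> M) (I \<times> N) (direction_field v) F) \<and>
         (\<exists>\<Phi>. time_preserving I M M \<Phi> \<and> Ck_diffeo r (I \<times> M) (I \<times> M) \<Phi> \<and>
            (\<forall>t\<in>I. \<forall>x\<in>M.
               frechet_derivative (inv_into (I \<times> M) \<Phi>) (at (t, x)) (1, v (t, x)) = (1, 0)))"
proof -
  have "continuous_on (I \<times> M) v"
    using Ck_on_of_Ck_fam[OF Ck_fam_mono[OF Ck_fam_of_Ck_on[OF assms(6)], of 0], of 0]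
      open_Times[OF assms(1,4)] by simp
  then interpret complete_ode I M v L
    by unfold_locales (use assms in blast)+
  obtain t0 where t0: "t0 \<in> I" using assms(3) by blast
  obtain j where j: "r = Suc j" using assms(5) by (cases r) auto
  note v = assms(6)
  have "time_preserving I M M (straighten t0) \<and>
      rectification r (I \<times> M) (I \<times> M) (direction_field v) (straighten t0)"
    using time_preserving_straighten(1)[OF v assms(5) t0] rectification_straighten[OF v[unfolded j] t0] j
    by simp
  moreover have "time_preserving I M M (unstraighten t0) \<and>
      Ck_diffeo r (I \<times> M) (I \<times> M) (unstraighten t0) \<and> (\<forall>t\<in>I. \<forall>x\<in>M.
        frechet_derivative (inv_into (I \<times> M) (unstraighten t0)) (at (t, x)) (1, v (t, x)) = (1, 0))"
    using time_preserving_straighten(2)[OF v assms(5) t0] Ck_diffeo_straighten(2)[OF v t0]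
      inv_unstraighten_derivative[OF v[unfolded j] t0] by blast
  ultimately show ?thesis by blast
qed

end
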